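(* Let $m\ge 2$, let $\{a_1,\dots,a_m\}$ be an alphabet with letter probabilities $p_1,\dots,p_m>0$, $\sum_{j=1}^m p_j=1$, and let $h=-\sum_{j=1}^m p_j\ln p_j$. Let $T$ be a fixed motif of size $\tau\ge 2$ with shape functional $\mathbf{Q}(T)$, and let $X_{n,T}$ be the number of occurrences of $T$ in an $m$-ary trie constructed over $n$ independent strings from this alphabet. Then there is a (possibly zero) fluctuating function $\xi_T$ with average value zero such that, as $n\to\infty$, $$\mathbb{E}[X_{n,T}]=\frac{\mathbf{Q}(T)}{\tau(\tau-1)h}\,n+\xi_T(n)\,n+o(n).$$ The function $\xi_T$ is identically $0$ when the probabilities $(p_1,\dots,p_m)$ are not periodic.
   Context: Source and strings. $\mathcal{A}=\{a_1,\dots,a_m\}$, and $\mathcal{A}^*$ is the set of all finite words over $\mathcal{A}$ (including the empty word). The strings $S_1,S_2,\dots$ are independent infinite words, and the successive letters of each are i.i.d., equal to $a_j$ with probability $p_j$ (memoryless source). For a finite word $w=a_{i_1}\cdots a_{i_\ell}$ put $\mathbb{P}(w)=p_{i_1}\cdots p_{i_\ell}$. Tries. The $m$-ary trie on $n$ distinct strings is defined recursively: it is empty if $n=0$; it is a single external node holding the string if $n=1$; if $n>1$ it has an internal root with $m$ ordered subtrees, the $j$th being the trie built on the strings starting with $a_j$ (branching at level $\ell$ uses the $(\ell+1)$st letter). For $n\ge2$ its shape is determined by the set $\{W_1,\dots,W_n\}$, where $W_i$ is the shortest prefix of $S_i$ that is not a prefix of any other $S_j$. Motifs. A motif (trie shape)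 of size $\tau\ge2$ is a set $T=\{W_1,\dots,W_\tau\}$ of $\tau$ nonempty finite words such that, for each $i$, $W_i$ is not a prefix of any other $W_j$, and deleting the last letter of $W_i$ gives a prefix of at least one other $W_j$. An occurrence of $T$ (on the fringe) in the trie on $S_1,\dots,S_n$ is a word $w\in\mathcal{A}^*$ such that exactly $\tau$ of the strings have prefix $w$ and the trie on these $\tau$ strings, after deleting the prefix $w$, has shape $T$. $X_{n,T}$ is the number of such $w$. Shape functional. $\mathbf{Q}(T)$ is the probability that the trie on $\tau$ random strings has shape $T$; explicitly $\mathbf{Q}(T)=\tau!\prod_{j=1}^\tau\mathbb{P}(W_j)$. Periodicity. The probabilities are periodic if $\ln p_j/\ln p_k$ is rational for all $1\le j,k\le m$, and aperiodic otherwise. Fluctuating functions. A fluctuating (oscillating) function is a function $x\mapsto P(\ln x)$ on $(0,\infty)$ with $P:\mathbb{R}\to\mathbb{R}$ continuous and periodic (possibly identically zero); it has average value zero if the integral of $P$ over a period is $0$. *)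

theory Defs
  imports "HOL-Probability.Probability" "HOL-Library.Sublist" "HOL-Library.Landau_Symbols"
begin

definition word_prefix :: "'a list \<Rightarrow> 'a stream \<Rightarrow> bool" where
  "word_prefix w s \<longleftrightarrow> stake (length w) s = w"

definition shortest_unique_prefix ::
    "'i set \<Rightarrow> ('i \<Rightarrow> 'a stream) \<Rightarrow> 'i \<Rightarrow> 'a list \<Rightarrow> bool" where
  "shortest_unique_prefix I s i w \<longleftrightarrow>
     word_prefix w (s i) \<and>
     (\<forall>j\<in>I - {i}. \<not> word_prefix w (s j)) \<and>
     (\<forall>v. strict_prefix v w \<longrightarrow> (\<exists>j\<in>I - {i}. word_prefix v (s j)))"

text \<open>
  The shape of the trie on the strings \<open>s i\<close>, \<open>i \<in> I\<close>, as a set of words. If two of the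
  strings coincide (a null event for a random source) neither contributes a word.
\<close>

definition trie_shape :: "'i set \<Rightarrow> ('i \<Rightarrow> 'a stream) \<Rightarrow> 'a list set" where
  "trie_shape I s = {w. \<exists>i\<in>I. shortest_unique_prefix I s i w}"

text \<open>
  The recursive construction of the trie itself; \<open>external_words_eq_trie_shape\<close> below shows that
  the words leading from the root to the external nodes are those in \<open>trie_shape\<close>.
\<close>

datatype 'a trie = Empty | External "'a stream" | Internal "'a \<Rightarrow> 'a trie"

inductive is_trie :: "'i set \<Rightarrow> ('i \<Rightarrow> 'a stream) \<Rightarrow> 'a trie \<Rightarrow> bool" where
  is_trie_empty: "is_trie {} s Empty"
| is_trie_external: "is_trie {i} s (External (s i))"
| is_trie_internal:
    "card I > 1 \<Longrightarrow> (\<And>a. is_trie {i \<in> I. shd (s i) = a} (\<lambda>i. stl (s i)) (t a)) \<Longrightarrow>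
       is_trie I s (Internal t)"

primrec external_words :: "'a trie \<Rightarrow> 'a list set" where
  "external_words Empty = {}"
| "external_words (External _) = {[]}"
| "external_words (Internal t) = (\<Union>a. Cons a ` external_words (t a))"

lemma word_prefix_Nil [simp]: "word_prefix [] s"
  by (simp add: word_prefix_def)

lemma word_prefix_Cons [simp]: "word_prefix (a # w) s \<longleftrightarrow> shd s = a \<and> word_prefix w (stl s)"
  by (auto simp: word_prefix_def)

lemma shortest_unique_prefix_Cons:
  assumes "i \<in> I" "card I > 1"
  shows "shortest_unique_prefix I s i (a # w) \<longleftrightarrow>
    shd (s i) = a \<and> shortest_unique_prefix {i \<in> I. shd (s i) = a} (\<lambda>i. stl (s i)) i w"
proof -
  have "I \<noteq> {i}" using assms by auto
  then obtain j where "j \<in> I" "j \<noteq> i" using assms by blast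
  then have ex: "\<exists>j\<in>I - {i}. word_prefix [] (s j)" by auto
  have "(\<forall>v. strict_prefix v (a # w) \<longrightarrow> (\<exists>j\<in>I - {i}. word_prefix v (s j))) \<longleftrightarrow>
     (\<forall>v. strict_prefix v w \<longrightarrow>
        (\<exists>j\<in>{i \<in> I. shd (s i) = a} - {i}. word_prefix v (stl (s j))))" (is "?L \<longleftrightarrow> ?R")
  proof
    assume L: ?L
    show ?R
    proof (intro allI impI)
      fix v assume "strict_prefix v w"
      then have "strict_prefix (a # v) (a # w)" by simp
      with L obtain j where "j \<in> I - {i}" "word_prefix (a # v) (s j)" by blast
      then show "\<exists>j\<in>{i \<in> I. shd (s i) = a} - {i}. word_prefix v (stl (s j))" by auto
    qed
  next
    assume R: ?R
    show ?L
    proof (intro allI impI)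
      fix v assume v: "strict_prefix v (a # w)"
      show "\<exists>j\<in>I - {i}. word_prefix v (s j)"
      proof (cases v)
        case Nil
        with ex show ?thesis by simp
      next
        case (Cons b u)
        with v have "b = a" "strict_prefix u w" by auto
        with R Cons show ?thesis by fastforce
      qed
    qed
  qed
  then show ?thesis unfolding shortest_unique_prefix_def by auto
qed

lemma external_words_eq_trie_shape:
  assumes "is_trie I s t"
  shows "external_words t = trie_shape I s"
  using assms
proof (induction rule: is_trie.induct)
  case (is_trie_empty s)
  show ?case by (simp add: trie_shape_def)
next
  case (is_trie_external i s)
  have "w = []" if "\<forall>v. \<not> strict_prefix v w" for w :: "'b list"
    using that[rule_format, of "[]"] by (cases w) auto
  then show ?case by (auto simp: trie_shape_def shortest_unique_prefix_def)
next
  case (is_trie_internal I s t)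
  have nil: "\<not> shortest_unique_prefix I s i []" if "i \<in> I" for i
  proof -
    have "I \<noteq> {i}" using is_trie_internal.hyps by auto
    then show ?thesis using that by (auto simp: shortest_unique_prefix_def)
  qed
  show ?case
  proof (rule set_eqI)
    fix w
    show "w \<in> external_words (Internal t) \<longleftrightarrow> w \<in> trie_shape I s"
    proof (cases w)
      case Nil
      then show ?thesis using nil by (auto simp: trie_shape_def)
    next
      case (Cons a u)
      then have "w \<in> external_words (Internal t) \<longleftrightarrow>
          u \<in> trie_shape {i \<in> I. shd (s i) = a} (\<lambda>i. stl (s i))"
        using is_trie_internal.IH by auto
      also have "\<dots> \<longleftrightarrow> w \<in> trie_shape I s"
        using shortest_unique_prefix_Cons[of _ I s a u] is_trie_internal.hyps Cons
        by (auto simp: trie_shape_def)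
      finally show ?thesis .
    qed
  qed
qed

definition motif :: "'a list set \<Rightarrow> bool" where
  "motif T \<longleftrightarrow> finite T \<and> card T \<ge> 2 \<and>
     (\<forall>w\<in>T. w \<noteq> [] \<and>
        (\<forall>v\<in>T - {w}. \<not> prefix w v) \<and>
        (\<exists>v\<in>T - {w}. prefix (butlast w) v))"

definition occurs_at :: "'a list set \<Rightarrow> 'i set \<Rightarrow> ('i \<Rightarrow> 'a stream) \<Rightarrow> 'a list \<Rightarrow> bool" where
  "occurs_at T I s w \<longleftrightarrow>
     (let J = {i \<in> I. word_prefix w (s i)}
      in card J = card T \<and> trie_shape J (\<lambda>i. sdrop (length w) (s i)) = T)"

text \<open>The strings are numbered from \<open>0\<close>, so the first \<open>n\<close> of them are \<open>s i\<close>, \<open>i < n\<close>.\<close>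

definition occurrences :: "'a list set \<Rightarrow> nat \<Rightarrow> (nat \<Rightarrow> 'a stream) \<Rightarrow> nat" where
  "occurrences T n s = card {w. occurs_at T {..<n} s w}"

definition shape_functional ::
    "'w measure \<Rightarrow> (nat \<Rightarrow> 'w \<Rightarrow> 'a stream) \<Rightarrow> 'a list set \<Rightarrow> real" where
  "shape_functional M S T =
     measure M {\<omega> \<in> space M. trie_shape {..<card T} (\<lambda>i. S i \<omega>) = T}"

definition memoryless_source ::
    "'w measure \<Rightarrow> ('a \<Rightarrow> real) \<Rightarrow> (nat \<Rightarrow> 'w \<Rightarrow> 'a stream) \<Rightarrow> bool" where
  "memoryless_source M p S \<longleftrightarrow>
     prob_space.indep_vars M (\<lambda>_. stream_space (count_space UNIV)) S UNIV \<and>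
     (\<forall>i. prob_space.indep_vars M (\<lambda>_. count_space UNIV) (\<lambda>k \<omega>. S i \<omega> !! k) UNIV) \<and>
     (\<forall>i k a. measure M {\<omega> \<in> space M. S i \<omega> !! k = a} = p a)"

definition source_entropy :: "('a::finite \<Rightarrow> real) \<Rightarrow> real" where
  "source_entropy p = - (\<Sum>a\<in>UNIV. p a * ln (p a))"

definition periodic_probs :: "('a \<Rightarrow> real) \<Rightarrow> bool" where
  "periodic_probs p \<longleftrightarrow> (\<forall>a b. ln (p a) / ln (p b) \<in> \<rat>)"

text \<open>
  Values of \<open>\<xi>\<close> outside \<open>(0,\<infinity>)\<close> are irrelevant. A constant \<open>P\<close> is allowed (with any \<open>d > 0\<close>
  as a period); having average zero, it must then vanish.
\<close>

definition fluctuating_mean_zero :: "(real \<Rightarrow> real) \<Rightarrow> bool" where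
  "fluctuating_mean_zero \<xi> \<longleftrightarrow>
     (\<exists>P d. d > 0 \<and> continuous_on UNIV P \<and> (\<forall>x. P (x + d) = P x) \<and>
        integral {0..d} P = 0 \<and> (\<forall>x>0. \<xi> x = P (ln x)))"

end

theory Submission
  imports Defs "HOL-Real_Asymp.Real_Asymp"
begin

text \<open>
  Write \<open>P w\<close> for the probability of a word \<open>w\<close>, \<open>\<tau> = card T\<close>, \<open>Q\<close> for the shape functional and
  \<open>h\<close> for the entropy. An occurrence at \<open>w\<close> amounts to an injective assignment of strings to the
  words of \<open>T\<close>: the string assigned to \<open>W\<close> starts with \<open>w @ W\<close>, and all other strings do not start
  with \<open>w\<close>. The assignment is unique, so its \<open>\<tau>! (n choose \<tau>)\<close> possible values contribute disjoint
  events, and independence gives the probability \<open>Q (n choose \<tau>) P(w)^\<tau> (1 - P(w))^(n - \<tau>)\<close>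
  (\<open>prob_occurs_at\<close>); the expectation is the sum of this over all words.

  Replacing the binomial weight by its Poisson limit changes the sum by \<open>O(1)\<close> only
  (\<open>word_sum_depoissonize\<close>), so the expectation divided by \<open>n\<close> is \<open>Q G(ln n) + O(1/n)\<close>, where
  \<open>G(t)\<close> is the sum of \<open>P(w) \<phi>(e^t P(w))\<close> over all words and \<open>\<phi>(x) = x^(\<tau>-1) e^(-x) / \<tau>!\<close>.
  Splitting off the first letter of \<open>w\<close> shows that \<open>G\<close> solves the renewal equation
  \<open>G(t) = g(t) + (\<Sum>a. p a * G(t - l a))\<close> with \<open>g(t) = \<phi>(e^t)\<close> and steps \<open>l a = - ln (p a)\<close>, whose mean
  is \<open>h\<close>. All word sums are controlled by one explicit supersolution of this equation
  (\<open>supersolution\<close>): it makes \<open>G\<close> bounded and Lipschitz continuous.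

  The limit behaviour of \<open>G\<close> rests on two facts. First, every step is an asymptotic period:
  \<open>G(t) - G(t - l a)\<close> tends to \<open>0\<close> (\<open>asymptotic_period_step\<close>), because a bounded solution cannot keep
  increasing along an arithmetic progression. Second, if \<open>\<Gamma>' = G\<close> then
  \<open>\<Sum>a. p a * (\<Gamma>(t) - \<Gamma>(t - l a))\<close> equals the integral of \<open>g\<close> up to \<open>t\<close> (\<open>mass_balance\<close>), which tends to
  \<open>c = 1 / (\<tau> (\<tau> - 1))\<close>.

  The asymptotic periods form a subgroup of the reals. If it has arbitrarily small positive elements,
  \<open>G\<close> becomes flat at infinity, and the balance forces the limit \<open>c / h\<close>. Otherwise it consists of the
  multiples of some \<open>d > 0\<close>, and \<open>G\<close> approaches a continuous function of period \<open>d\<close>, whose mean is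
  \<open>c / h\<close>, again by the balance; its deviation from the mean, multiplied by \<open>Q\<close>, is the fluctuation.
  In this second case each \<open>ln (p a)\<close> is an integer multiple of \<open>d\<close>, so the probabilities are
  periodic.
\<close>

section \<open>Asymptotic periods\<close>

definition asymptotic_period :: "(real \<Rightarrow> real) \<Rightarrow> real \<Rightarrow> bool" where
  "asymptotic_period G a \<longleftrightarrow> ((\<lambda>t. G t - G (t - a)) \<longlongrightarrow> 0) at_top"

lemma filterlim_shift_at_top: "filterlim (\<lambda>t. t - a) at_top (at_top :: real filter)"
  using filterlim_tendsto_add_at_top[OF tendsto_const[of "-a"] filterlim_ident] by simp

lemma asymptotic_period_0: "asymptotic_period G 0"
  by (simp add: asymptotic_period_def)

lemma asymptotic_period_minus:
  assumes "asymptotic_period G a"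
  shows "asymptotic_period G (- a)"
proof -
  have "((\<lambda>t. - (G (t - (-a)) - G ((t - (-a)) - a))) \<longlongrightarrow> - 0) at_top"
    using filterlim_compose[OF assms[unfolded asymptotic_period_def] filterlim_shift_at_top]
    by (rule tendsto_minus)
  then show ?thesis by (simp add: asymptotic_period_def)
qed

lemma asymptotic_period_add:
  assumes "asymptotic_period G a" "asymptotic_period G b"
  shows "asymptotic_period G (a + b)"
proof -
  have "((\<lambda>t. (G t - G (t - a)) + (G (t - a) - G ((t - a) - b))) \<longlongrightarrow> 0 + 0) at_top"
    using assms unfolding asymptotic_period_def
    by (intro tendsto_add filterlim_compose[OF _ filterlim_shift_at_top, of "\<lambda>t. G t - G (t - b)"])
  then show ?thesis by (simp add: asymptotic_period_def algebra_simps)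
qed

lemma asymptotic_period_diff:
  "asymptotic_period G a \<Longrightarrow> asymptotic_period G b \<Longrightarrow> asymptotic_period G (a - b)"
  using asymptotic_period_add[of G a "-b"] asymptotic_period_minus[of G b] by simp

lemma asymptotic_period_nat_mult:
  "asymptotic_period G a \<Longrightarrow> asymptotic_period G (real k * a)"
  by (induction k) (auto simp: asymptotic_period_0 algebra_simps intro: asymptotic_period_add)

lemma asymptotic_period_int_mult:
  "asymptotic_period G a \<Longrightarrow> asymptotic_period G (of_int k * a)"
  using asymptotic_period_nat_mult[of G a] asymptotic_period_minus[of G "real _ * a"]
  by (cases k rule: int_cases2) auto

text \<open>
  An additive subgroup of the reals with a positive element is either dense or generated by its least
  positive element; here it is the group of asymptotic periods.
\<close>

lemma asymptotic_periods_dichotomy: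
  assumes "asymptotic_period G l" "l > 0"
  obtains (dense) "\<And>\<delta>. \<delta> > 0 \<Longrightarrow> \<exists>a. asymptotic_period G a \<and> 0 < a \<and> a < \<delta>"
  | (lattice) d where "d > 0" "asymptotic_period G d"
      "\<And>a. asymptotic_period G a \<Longrightarrow> \<exists>k::int. a = of_int k * d"
proof (cases "\<forall>\<delta>>0. \<exists>a. asymptotic_period G a \<and> 0 < a \<and> a < \<delta>")
  case True
  then show ?thesis using dense by blast
next
  case False
  then obtain \<delta> where \<delta>: "\<delta> > 0" "\<And>a. asymptotic_period G a \<Longrightarrow> 0 < a \<Longrightarrow> \<delta> \<le> a"
    by (force simp: not_less)
  define P where "P = {a. asymptotic_period G a \<and> 0 < a}"
  have ne: "P \<noteq> {}" and bdd: "bdd_below P"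
    using assms by (auto simp: P_def intro: bdd_belowI[of _ 0])
  define d where "d = Inf P"
  have ge: "d \<le> a" if "a \<in> P" for a
    using that bdd by (simp add: d_def cInf_lower)
  have "d \<ge> \<delta>" using ne \<delta> unfolding d_def P_def by (intro cInf_greatest) auto
  then have dpos: "d > 0" using \<delta>(1) by simp
  \<comment> \<open>If the infimum were not attained, two distinct periods slightly above it would differ by
    a positive period smaller than \<open>\<delta>\<close>.\<close>
  have "d \<in> P"
  proof (rule ccontr)
    assume nd: "d \<notin> P"
    obtain a where a: "a \<in> P" "a < d + \<delta>"
      using ne \<delta>(1) cInf_lessD[of P "d + \<delta>"] unfolding d_def by auto
    then have "d < a" using ge[OF a(1)] nd by (cases "a = d") auto
    then obtain b where b: "b \<in> P" "b < a"
      using ne cInf_lessD[of P a] unfolding d_def by auto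
    have "asymptotic_period G (a - b)"
      using a b by (auto simp: P_def intro: asymptotic_period_diff)
    then show False using \<delta>(2)[of "a - b"] a b ge[of b] by auto
  qed
  have "\<exists>k::int. a = of_int k * d" if a: "asymptotic_period G a" for a
  proof -
    define k where "k = \<lfloor>a / d\<rfloor>"
    define r where "r = a - of_int k * d"
    have "of_int k \<le> a / d" "a / d < of_int k + 1" unfolding k_def by linarith+
    then have r: "0 \<le> r" "r < d" using dpos by (auto simp: r_def field_simps)
    have "asymptotic_period G r"
      unfolding r_def using a \<open>d \<in> P\<close>
      by (auto simp: P_def intro: asymptotic_period_diff asymptotic_period_int_mult)
    then have "r = 0" using r ge[of r] by (force simp: P_def)
    then show ?thesis by (auto simp: r_def)
  qed
  then show ?thesis using lattice[of d] \<open>d \<in> P\<close> by (auto simp: P_def)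
qed

text \<open>
  Convergence along each residue class modulo \<open>d\<close> is uniform in the class, because equicontinuity
  reduces it to finitely many classes spaced \<open>d / N\<close> apart.
\<close>

lemma lipschitz_lattice_tendsto:
  fixes H :: "real \<Rightarrow> real"
  assumes lip: "\<And>s t. \<bar>H t - H s\<bar> \<le> L * \<bar>t - s\<bar>"
    and "d > 0" and lim: "\<And>t. (\<lambda>k. H (t + real k * d)) \<longlonglongrightarrow> 0"
  shows "(H \<longlongrightarrow> 0) at_top"
proof (rule tendstoI)
  fix e :: real assume e: "e > 0"
  have Lpos: "L \<ge> 0" using lip[of 1 0] by simp
  obtain N :: nat where N: "N > 0" "L * d / real N < e / 2"
  proof -
    obtain n :: nat where "L * d / (e / 2) < real n" using reals_Archimedean2 by blast
    moreover have "L * d / (e/2) \<ge> 0" using Lpos e assms(2) by simp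
    ultimately have "n > 0" by (intro Nat.gr0I) auto
    then show ?thesis using that[of n] e \<open>L * d / (e / 2) < real n\<close> by (auto simp: field_simps)
  qed
  have "\<forall>j\<in>{..<N}. \<forall>\<^sub>F k in sequentially. \<bar>H (real j * (d / N) + real k * d)\<bar> < e / 2"
    using lim[THEN tendstoD, of "e/2"] e by (auto simp: dist_real_def)
  then have "\<forall>\<^sub>F k in sequentially. \<forall>j\<in>{..<N}. \<bar>H (real j * (d / N) + real k * d)\<bar> < e / 2"
    by (subst eventually_ball_finite_distrib) auto
  then obtain K where K: "\<And>k j. k \<ge> K \<Longrightarrow> j < N \<Longrightarrow> \<bar>H (real j * (d / N) + real k * d)\<bar> < e / 2"
    by (auto simp: eventually_sequentially)
  have "dist (H t) 0 < e" if t: "t \<ge> real K * d" for t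
  proof -
    define k where "k = nat \<lfloor>t / d\<rfloor>"
    have td: "t / d \<ge> real K" using t assms(2) by (simp add: field_simps)
    then have "\<lfloor>t/d\<rfloor> \<ge> int K" by (simp add: le_floor_iff)
    then have k: "k \<ge> K" "real k \<le> t / d" "t / d < real k + 1"
      unfolding k_def using td by (auto simp: le_nat_iff)
    define r where "r = t - real k * d"
    have r: "0 \<le> r" "r < d" using k assms(2) by (auto simp: r_def field_simps)
    define j where "j = nat \<lfloor>r / (d / N)\<rfloor>"
    have "r / (d/N) \<ge> 0" using r assms(2) by simp
    then have j: "real j \<le> r / (d / N)" "r / (d / N) < real j + 1"
      unfolding j_def by linarith+
    have "r / (d/N) < real N" using r N assms(2) by (simp add: field_simps)
    with j have jN: "j < N" by linarith
    define u where "u = real j * (d / N) + real k * d"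
    have "\<bar>t - u\<bar> \<le> d / N"
    proof -
      have "real j * (d/N) \<le> r" "r < (real j + 1) * (d/N)"
        using j N assms(2) by (auto simp: field_simps)
      then have "\<bar>r - real j * (d/N)\<bar> \<le> d/N" unfolding distrib_right by linarith
      then show ?thesis by (simp add: u_def r_def algebra_simps)
    qed
    then have "\<bar>H t - H u\<bar> \<le> L * (d / N)"
      using lip[of t u] Lpos by (meson mult_left_mono order_trans)
    moreover have "\<bar>H u\<bar> < e / 2" using K[OF k(1) jN] by (simp add: u_def)
    ultimately have "\<bar>H t\<bar> < e" using N(2) unfolding times_divide_eq_right by linarith
    then show ?thesis by simp
  qed
  then show "\<forall>\<^sub>F t in at_top. dist (H t) 0 < e"
    by (auto simp: eventually_at_top_linorder)
qed

lemma continuous_antiderivative: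
  fixes f :: "real \<Rightarrow> real"
  assumes "continuous_on UNIV f"
  obtains F where "\<And>x. (F has_real_derivative f x) (at x)"
proof -
  have "\<exists>F. \<forall>x :: real. -\<infinity> < ereal x \<longrightarrow> ereal x < \<infinity> \<longrightarrow> (F has_vector_derivative f x) (at x)"
    using assms by (intro einterval_antiderivative) (auto simp: continuous_on_eq_continuous_at)
  then show ?thesis using that by (auto simp: has_real_derivative_iff_has_vector_derivative)
qed

lemma antiderivative_increment:
  fixes F f :: "real \<Rightarrow> real"
  assumes "\<And>x. (F has_real_derivative f x) (at x)" "l > 0"
  obtains x where "t - l < x" "x < t" "F t - F (t - l) = l * f x"
  using MVT2[of "t - l" t F f] assms by auto

lemma antiderivative_increment_tendsto_0:
  fixes F f :: "real \<Rightarrow> real"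
  assumes F: "\<And>x. (F has_real_derivative f x) (at x)" and l: "l > 0"
    and f: "(f \<longlongrightarrow> 0) at_top"
  shows "((\<lambda>t. F t - F (t - l)) \<longlongrightarrow> 0) at_top"
proof (rule tendstoI)
  fix e :: real assume e: "e > 0"
  obtain T where T: "\<And>t. t \<ge> T \<Longrightarrow> \<bar>f t\<bar> < e / l"
    using tendstoD[OF f, of "e / l"] e l by (auto simp: eventually_at_top_linorder dist_real_def)
  have "dist (F t - F (t - l)) 0 < e" if "t \<ge> T + l" for t
  proof -
    obtain x where "t - l < x" "x < t" "F t - F (t - l) = l * f x"
      using antiderivative_increment[of F f l t] F l by blast
    then show ?thesis using T[of x] that l by (auto simp: dist_real_def abs_mult field_simps)
  qed
  then show "\<forall>\<^sub>F t in at_top. dist (F t - F (t - l)) 0 < e"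
    by (auto simp: eventually_at_top_linorder)
qed

section \<open>The renewal equation\<close>

locale renewal_equation =
  fixes p l :: "'a::finite \<Rightarrow> real" and g G :: "real \<Rightarrow> real" and B :: real
  assumes p_pos: "p a > 0" and p_sum: "(\<Sum>a\<in>UNIV. p a) = 1" and l_pos: "l a > 0"
    and renewal: "G t = g t + (\<Sum>a\<in>UNIV. p a * G (t - l a))"
    and bounded: "\<bar>G t\<bar> \<le> B"
    and g_top: "(g \<longlongrightarrow> 0) at_top"
begin

definition mean_step :: real where "mean_step = (\<Sum>a\<in>UNIV. p a * l a)"

lemma mean_step_pos: "mean_step > 0"
  unfolding mean_step_def using p_pos l_pos by (intro sum_pos) auto

lemma sum_increments: "(\<Sum>a\<in>UNIV. p a * (G t - G (t - l a))) = g t"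
  using renewal[of t] p_sum
  by (simp add: right_diff_distrib sum_subtractf sum_distrib_right[symmetric])

text \<open>
  Let \<open>s\<close> be the limit superior of \<open>D(t) = G(t) - G(t - l i)\<close>. Up to a vanishing error, \<open>D(t)\<close> is a
  weighted mean of the values \<open>D(t - l a)\<close>, so if \<open>D\<close> is close to \<open>s\<close> at a late time \<open>t\<close>, it is still
  close to \<open>s\<close> at \<open>t - l i\<close>, and hence at \<open>t - k * l i\<close> for all \<open>k < K\<close>. Summing these values gives
  an increment of \<open>G\<close> of about \<open>K * s\<close>, and boundedness of \<open>G\<close> leaves only \<open>s \<le> 0\<close>.
\<close>

lemma eventually_increment_le:
  assumes "\<epsilon> > 0"
  shows "\<forall>\<^sub>F t in at_top. G t - G (t - l i) \<le> \<epsilon>"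
proof -
  define D where "D t = G t - G (t - l i)" for t
  define S where "S = {b. \<forall>\<^sub>F t in at_top. D t \<le> b}"
  define s where "s = Inf S"
  have Db: "\<bar>D t\<bar> \<le> 2 * B" for t
    using bounded[of t] bounded[of "t - l i"] unfolding D_def by linarith
  have "2 * B \<in> S" using Db by (auto simp: S_def intro!: always_eventually dest: abs_le_D1)
  then have ne: "S \<noteq> {}" by auto
  have lb: "- 2 * B \<le> b" if "b \<in> S" for b
  proof -
    obtain t where "D t \<le> b"
      using \<open>b \<in> S\<close> eventually_happens'[of "at_top :: real filter" "\<lambda>t. D t \<le> b"]
      by (auto simp: S_def)
    then show ?thesis using Db[of t] by linarith
  qed
  have bdd: "bdd_below S" using lb by (intro bdd_belowI)
  \<comment> \<open>\<open>s\<close> is the limit superior of \<open>D\<close>: \<open>above\<close> and \<open>below\<close> are its two defining properties.\<close>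
  have above: "\<forall>\<^sub>F t in at_top. D t \<le> s + e" if e: "e > 0" for e
  proof -
    obtain b where "b \<in> S" "b < s + e"
      using ne cInf_lessD[of S "s + e"] e unfolding s_def by auto
    then show ?thesis by (auto simp: S_def elim!: eventually_mono)
  qed
  have below: "\<exists>t\<ge>T. D t > s - e" if e: "e > 0" for e T
  proof (rule ccontr)
    assume "\<not> ?thesis"
    then have "s - e \<in> S" by (force simp: S_def eventually_at_top_linorder not_less)
    then show False using bdd cInf_lower[of "s - e" S] e unfolding s_def by simp
  qed
  have "s \<le> 0"
  proof (rule ccontr)
    assume "\<not> s \<le> 0"
    then have s: "s > 0" by simp
    define q where "q = p i"
    have q: "0 < q" "q \<le> 1"
      using p_pos[of i] member_le_sum[of i UNIV p] p_pos p_sum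
      by (auto simp: q_def less_imp_le)
    obtain K :: nat where K: "2 * B / (s / 2) < real K" using reals_Archimedean2 by blast
    have r1: "3 / q \<ge> 1" using q by (simp add: field_simps)
    \<comment> \<open>Each step back multiplies the error by at most \<open>3 / q\<close>; after \<open>K\<close> steps it has grown to \<open>s / 2\<close>.\<close>
    define e where "e = (s / 2) / (3 / q) ^ K"
    have e: "e > 0" using s q by (simp add: e_def)
    have "((\<lambda>t. g t - g (t - l i)) \<longlongrightarrow> 0 - 0) at_top"
      by (intro tendsto_diff g_top filterlim_compose[OF g_top filterlim_shift_at_top])
    then have "\<forall>\<^sub>F t in at_top. \<bar>g t - g (t - l i)\<bar> < e"
      using tendstoD[of "\<lambda>t. g t - g (t - l i)" 0 at_top e] e by (simp add: dist_real_def)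
    with above[OF e] have "\<forall>\<^sub>F t in at_top. D t \<le> s + e \<and> \<bar>g t - g (t - l i)\<bar> < e"
      by eventually_elim auto
    then obtain T where T: "\<And>t. t \<ge> T \<Longrightarrow> D t \<le> s + e"
        "\<And>t. t \<ge> T \<Longrightarrow> \<bar>g t - g (t - l i)\<bar> < e"
      by (auto simp: eventually_at_top_linorder)
    define m where "m = (\<Sum>a\<in>UNIV. l a)"
    have lm: "l a \<le> m" for a unfolding m_def
      using l_pos by (intro member_le_sum) (auto intro: less_imp_le)
    obtain t where t: "t \<ge> T + real K * l i + m" "D t > s - e" using below[OF e] by blast
    have D_eq: "D u = (g u - g (u - l i)) + (\<Sum>a\<in>UNIV. p a * D (u - l a))" for u
      using renewal[of u] renewal[of "u - l i"]
      by (simp add: D_def algebra_simps sum_subtractf sum.distrib)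

    have chain: "k \<le> K \<Longrightarrow> D (t - real k * l i) \<ge> s - e * (3 / q) ^ k" for k
    proof (induction k)
      case 0
      then show ?case using t by simp
    next
      case (Suc k)
      define u where "u = t - real k * l i"
      have "real k * l i \<le> real K * l i" using Suc.prems l_pos[of i] by simp
      then have u: "u \<ge> T + m" using t(1) unfolding u_def by linarith
      moreover have "m \<ge> 0" using lm[of i] l_pos[of i] by linarith
      ultimately have "u \<ge> T" by simp
      have "(\<Sum>a\<in>UNIV. p a * D (u - l a)) = q * D (u - l i) + (\<Sum>a\<in>UNIV-{i}. p a * D (u - l a))"
        by (subst sum.remove[of UNIV i]) (auto simp: q_def)
      also have "(\<Sum>a\<in>UNIV-{i}. p a * D (u - l a)) \<le> (\<Sum>a\<in>UNIV-{i}. p a * (s + e))"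
      proof (intro sum_mono mult_left_mono T(1))
        fix a show "T \<le> u - l a" using u lm[of a] by linarith
      qed (auto intro: less_imp_le p_pos)
      also have "\<dots> = (1 - q) * (s + e)"
        using p_sum sum.remove[of UNIV i p] by (simp add: q_def sum_distrib_right[symmetric])
      finally have "D u \<le> e + (q * D (u - l i) + (1 - q) * (s + e))"
        using D_eq[of u] T(2)[OF \<open>u \<ge> T\<close>] by linarith
      moreover have "D u \<ge> s - e * (3 / q) ^ k" using Suc by (simp add: u_def)
      ultimately have "q * D (u - l i) \<ge> q * s - e * ((3/q)^k + 2 - q)"
        by (simp add: algebra_simps)
      moreover have "e * ((3/q)^k + 2 - q) \<le> e * (3 * (3/q)^k)"
      proof (intro mult_left_mono)
        have "(3/q)^k \<ge> 1" using r1 by (rule one_le_power)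
        then show "(3/q)^k + 2 - q \<le> 3 * (3/q)^k" using q by linarith
      qed (use e in auto)
      ultimately have "q * D (u - l i) \<ge> q * (s - e * (3/q)^Suc k)"
        using q by (simp add: algebra_simps)
      then have "D (u - l i) \<ge> s - e * (3/q)^Suc k" using q by simp
      then show ?case by (simp add: u_def algebra_simps)
    qed
    have half: "D (t - real k * l i) \<ge> s / 2" if "k < K" for k
    proof -
      have "e * (3/q)^k \<le> e * (3/q)^K"
        using that r1 e by (intro mult_left_mono power_increasing) auto
      also have "\<dots> = s / 2" using q by (simp add: e_def)
      finally show ?thesis using chain[of k] that by simp
    qed
    have "real K * (s / 2) \<le> (\<Sum>k<K. D (t - real k * l i))"
      using sum_mono[of "{..<K}" "\<lambda>_. s / 2" "\<lambda>k. D (t - real k * l i)"] half by auto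
    also have "\<dots> = (\<Sum>k<K. G (t - real k * l i) - G (t - real (Suc k) * l i))"
      by (simp add: D_def algebra_simps)
    also have "\<dots> = G t - G (t - real K * l i)"
      by (subst sum_lessThan_telescope') simp
    also have "\<dots> \<le> 2 * B"
      using bounded[of t] bounded[of "t - real K * l i"] by linarith
    finally show False using K s by (simp add: field_simps)
  qed
  then show ?thesis using above[OF assms] by (auto simp: D_def elim!: eventually_mono)
qed

end

context renewal_equation begin

lemma asymptotic_period_step: "asymptotic_period G (l i)"
proof -
  \<comment> \<open>The negated equation turns the upper bound for increments into the lower bound.\<close>
  interpret minus: renewal_equation p l "\<lambda>t. - g t" "\<lambda>t. - G t" B
  proof
    show "- G t = - g t + (\<Sum>a\<in>UNIV. p a * - G (t - l a))" for t
      using renewal[of t] by (simp add: sum_negf)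
  qed (use p_pos p_sum l_pos bounded tendsto_minus[OF g_top] in auto)
  show ?thesis unfolding asymptotic_period_def
  proof (rule tendstoI)
    fix e :: real assume e: "e > 0"
    then have "0 < e / 2" by simp
    from eventually_increment_le[OF this, of i] minus.eventually_increment_le[OF this, of i]
    show "\<forall>\<^sub>F t in at_top. dist (G t - G (t - l i)) 0 < e"
    proof eventually_elim
      case (elim t)
      then show ?case using e by (simp add: dist_real_def)
    qed
  qed
qed

end

text \<open>
  \<open>I\<close> is the integral of \<open>g\<close> from minus infinity, and \<open>c\<close> the total mass of \<open>g\<close>.
\<close>

locale renewal_equation_with_mass = renewal_equation +
  fixes L c :: real and I :: "real \<Rightarrow> real"
  assumes lipschitz: "\<bar>G t - G s\<bar> \<le> L * \<bar>t - s\<bar>"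
    and G_bot: "(G \<longlongrightarrow> 0) at_bot"
    and g_nonneg: "g t \<ge> 0"
    and I_deriv: "(I has_real_derivative g t) (at t)"
    and I_bot: "(I \<longlongrightarrow> 0) at_bot" and I_top: "(I \<longlongrightarrow> c) at_top"
begin

lemma L_nonneg: "L \<ge> 0"
  using lipschitz[of 1 0] by simp

lemma continuous_G: "continuous_on UNIV G"
proof (rule lipschitz_on_continuous_on)
  show "L-lipschitz_on UNIV G"
    using lipschitz L_nonneg by (intro lipschitz_onI) (auto simp: dist_real_def)
qed

text \<open>
  By the renewal equation both sides have the derivative \<open>g\<close>, and both vanish at minus infinity.
  This identity is what determines the limit of \<open>G\<close>, of which the asymptotic periods say nothing.
\<close>

lemma mass_balance:
  assumes \<Gamma>: "\<And>t. (\<Gamma> has_real_derivative G t) (at t)"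
  shows "(\<Sum>a\<in>UNIV. p a * (\<Gamma> t - \<Gamma> (t - l a))) = I t"
proof -
  define \<Phi> where "\<Phi> t = (\<Sum>a\<in>UNIV. p a * (\<Gamma> t - \<Gamma> (t - l a))) - I t" for t
  have \<Gamma>': "((\<lambda>t. \<Gamma> (t - b)) has_real_derivative G (t - b)) (at t)" for t b
    using \<Gamma>[of "t - b"] DERIV_shift[of \<Gamma> "G (t - b)" t "- b"] by simp
  have "(\<Phi> has_real_derivative 0) (at t)" for t
  proof -
    have "(\<Phi> has_real_derivative (\<Sum>a\<in>UNIV. p a * (G t - G (t - l a))) - g t) (at t)"
      unfolding \<Phi>_def
      by (intro derivative_intros DERIV_cmult \<Gamma> \<Gamma>' I_deriv)
    also have "(\<Sum>a\<in>UNIV. p a * (G t - G (t - l a))) - g t = 0"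
      by (simp add: sum_increments)
    finally show ?thesis .
  qed
  then have const: "\<Phi> t = \<Phi> s" for s t
    using DERIV_isconst_all by blast
  have "((\<lambda>t. \<Gamma> t - \<Gamma> (t - l a)) \<longlongrightarrow> 0) at_bot" for a
  proof (rule tendstoI)
    fix e :: real assume e: "e > 0"
    obtain T where T: "\<And>t. t \<le> T \<Longrightarrow> \<bar>G t\<bar> < e / l a"
      using tendstoD[OF G_bot, of "e / l a"] e l_pos[of a]
      by (auto simp: eventually_at_bot_linorder dist_real_def)
    have "dist (\<Gamma> t - \<Gamma> (t - l a)) 0 < e" if "t \<le> T" for t
    proof -
      obtain x where "t - l a < x" "x < t" "\<Gamma> t - \<Gamma> (t - l a) = l a * G x"
        using antiderivative_increment[of \<Gamma> G "l a" t] \<Gamma> l_pos by blast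
      then show ?thesis using T[of x] that l_pos[of a]
        by (auto simp: dist_real_def abs_mult field_simps)
    qed
    then show "\<forall>\<^sub>F t in at_bot. dist (\<Gamma> t - \<Gamma> (t - l a)) 0 < e"
      by (auto simp: eventually_at_bot_linorder)
  qed
  then have "(\<Phi> \<longlongrightarrow> (\<Sum>a\<in>(UNIV::'a set). p a * 0) - 0) at_bot"
    unfolding \<Phi>_def by (intro tendsto_intros I_bot)
  moreover have "\<Phi> = (\<lambda>_. \<Phi> t)" using const by blast
  ultimately have "((\<lambda>_. \<Phi> t) \<longlongrightarrow> 0) (at_bot :: real filter)" by simp
  then have "\<Phi> t = 0" by (simp add: tendsto_const_iff)
  then show ?thesis by (simp add: \<Phi>_def)
qed

text \<open>
  A window of length \<open>b\<close> is covered by finitely many multiples of one small asymptotic period \<open>a\<close>;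
  between consecutive multiples the Lipschitz bound takes over.
\<close>

lemma dense_periods_uniform:
  assumes dense: "\<And>\<delta>. \<delta> > 0 \<Longrightarrow> \<exists>a. asymptotic_period G a \<and> 0 < a \<and> a < \<delta>"
    and e: "e > 0"
  shows "\<forall>\<^sub>F t in at_top. \<forall>u\<in>{0..b}. \<bar>G (t - u) - G t\<bar> < e"
proof -
  obtain a where a: "asymptotic_period G a" "0 < a" "a < e / (2 * (L + 1))"
    using dense[of "e / (2 * (L + 1))"] e L_nonneg by auto
  have La: "L * a < e / 2"
  proof -
    have "L * a \<le> (L + 1) * a" using a by simp
    also have "\<dots> < e / 2" using a(3) L_nonneg by (simp add: field_simps)
    finally show ?thesis .
  qed
  define N where "N = nat \<lceil>b / a\<rceil>"
  have "\<forall>k\<in>{..N}. \<forall>\<^sub>F t in at_top. \<bar>G t - G (t - real k * a)\<bar> < e / 2"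
    using tendstoD[OF asymptotic_period_nat_mult[OF a(1), unfolded asymptotic_period_def], of "e/2"] e
    by (simp add: dist_real_def)
  then have "\<forall>\<^sub>F t in at_top. \<forall>k\<in>{..N}. \<bar>G t - G (t - real k * a)\<bar> < e / 2"
    by (subst eventually_ball_finite_distrib) auto
  then show ?thesis
  proof eventually_elim
    case (elim t)
    show ?case
    proof
      fix u assume u: "u \<in> {0..b}"
      define k where "k = nat \<lfloor>u / a\<rfloor>"
      have "u / a \<ge> 0" using u a by simp
      then have k: "real k \<le> u / a" "u / a < real k + 1" unfolding k_def by linarith+
      have "u / a \<le> b / a" using u a by (simp add: divide_right_mono)
      then have "k \<le> N" using k unfolding N_def by linarith
      then have 1: "\<bar>G t - G (t - real k * a)\<bar> < e / 2" using elim by simp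
      have "\<bar>G (t - u) - G (t - real k * a)\<bar> \<le> L * \<bar>(t - u) - (t - real k * a)\<bar>"
        by (rule lipschitz)
      also have "\<dots> \<le> L * a"
      proof (intro mult_left_mono L_nonneg)
        show "\<bar>(t - u) - (t - real k * a)\<bar> \<le> a" using k a by (simp add: field_simps abs_le_iff)
      qed
      finally show "\<bar>G (t - u) - G t\<bar> < e" using 1 La by linarith
    qed
  qed
qed

text \<open>
  Since \<open>G\<close> is nearly constant on windows of the length of a step, \<open>\<Gamma>(t) - \<Gamma>(t - l a)\<close> is nearly
  \<open>l a * G(t)\<close>, and the mass balance becomes \<open>mean_step * G(t) \<longlonglongrightarrow> c\<close>.
\<close>

lemma tendsto_dense:
  assumes dense: "\<And>\<delta>. \<delta> > 0 \<Longrightarrow> \<exists>a. asymptotic_period G a \<and> 0 < a \<and> a < \<delta>"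
  shows "(G \<longlongrightarrow> c / mean_step) at_top"
proof -
  obtain \<Gamma> where \<Gamma>: "\<And>t. (\<Gamma> has_real_derivative G t) (at t)"
    using continuous_antiderivative[OF continuous_G] by blast
  have "((\<lambda>t. (\<Gamma> t - \<Gamma> (t - l a)) - l a * G t) \<longlongrightarrow> 0) at_top" for a
  proof (rule tendstoI)
    fix e :: real assume e: "e > 0"
    have "\<forall>\<^sub>F t in at_top. \<forall>u\<in>{0..l a}. \<bar>G (t - u) - G t\<bar> < e / l a"
      using dense e l_pos by (intro dense_periods_uniform) auto
    then show "\<forall>\<^sub>F t in at_top. dist ((\<Gamma> t - \<Gamma> (t - l a)) - l a * G t) 0 < e"
    proof eventually_elim
      case (elim t)
      obtain x where x: "t - l a < x" "x < t" "\<Gamma> t - \<Gamma> (t - l a) = l a * G x"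
        using antiderivative_increment[of \<Gamma> G "l a" t] \<Gamma> l_pos by blast
      have "\<bar>G (t - (t - x)) - G t\<bar> < e / l a" using elim x by (intro bspec[OF elim]) auto
      then have "l a * \<bar>G x - G t\<bar> < e" using l_pos[of a] by (simp add: field_simps)
      moreover have "l a * \<bar>G x - G t\<bar> = \<bar>l a * G x - l a * G t\<bar>"
        using l_pos[of a] by (simp add: abs_mult right_diff_distrib[symmetric])
      ultimately show ?case using x by (simp add: dist_real_def)
    qed
  qed
  then have "((\<lambda>t. I t - (\<Sum>a\<in>UNIV. p a * ((\<Gamma> t - \<Gamma> (t - l a)) - l a * G t)))
      \<longlongrightarrow> c - (\<Sum>a\<in>(UNIV::'a set). p a * 0)) at_top"
    by (intro tendsto_intros I_top)
  also have "(\<lambda>t. I t - (\<Sum>a\<in>UNIV. p a * ((\<Gamma> t - \<Gamma> (t - l a)) - l a * G t)))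
      = (\<lambda>t. mean_step * G t)"
  proof
    fix t
    show "I t - (\<Sum>a\<in>UNIV. p a * ((\<Gamma> t - \<Gamma> (t - l a)) - l a * G t)) = mean_step * G t"
      using mass_balance[OF \<Gamma>, of t]
      by (simp add: mean_step_def right_diff_distrib sum_subtractf sum_distrib_right mult.assoc)
  qed
  finally have "((\<lambda>t. mean_step * G t / mean_step) \<longlongrightarrow> c / mean_step) at_top"
    using mean_step_pos by (intro tendsto_divide tendsto_const) auto
  then show ?thesis using mean_step_pos by simp
qed

text \<open>
  Write \<open>l a = m a * d\<close>. The sum \<open>K\<close> below is a discrete counterpart of the mass balance: it increases
  by \<open>g \<ge> 0\<close> over a period \<open>d\<close>, so it converges along \<open>t + k * d\<close>. As \<open>d\<close> is an asymptotic period, \<open>K\<close>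
  is asymptotic to a constant multiple of \<open>G\<close>; hence \<open>G\<close> converges along \<open>t + k * d\<close> as well, to a
  periodic function \<open>H\<close> of \<open>t\<close>. Replacing \<open>G\<close> by \<open>H\<close> in the mass balance gives the mean of \<open>H\<close>.
\<close>

lemma tendsto_lattice:
  assumes d: "d > 0" and period: "asymptotic_period G d"
    and lattice: "\<And>a. \<exists>k::int. l a = of_int k * d"
  obtains H where "continuous_on UNIV H" "\<And>t. H (t + d) = H t"
    "integral {0..d} H = d * (c / mean_step)" "((\<lambda>t. G t - H t) \<longlongrightarrow> 0) at_top"
proof -
  have "\<exists>m::nat. l a = real m * d" for a
  proof -
    obtain k :: int where k: "l a = of_int k * d" using lattice by blast
    then have "k > 0" using l_pos[of a] d by (simp add: zero_less_mult_iff)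
    then show ?thesis using k by (intro exI[of _ "nat k"]) simp
  qed
  then obtain m :: "'a \<Rightarrow> nat" where m: "\<And>a. l a = real (m a) * d" by metis
  have h: "mean_step = (\<Sum>a\<in>UNIV. p a * real (m a)) * d"
    by (simp add: mean_step_def m sum_distrib_right mult.assoc)
  define \<mu> where "\<mu> = (\<Sum>a\<in>UNIV. p a * real (m a))"
  have \<mu>: "\<mu> > 0" "mean_step = \<mu> * d"
    using h mean_step_pos d by (auto simp: \<mu>_def zero_less_mult_iff)
  define K where "K t = (\<Sum>a\<in>UNIV. p a * (\<Sum>i<m a. G (t - real i * d)))" for t
  have K_step: "K t - K (t - d) = g t" for t
  proof -
    have "(\<Sum>i<m a. G (t - real i * d)) - (\<Sum>i<m a. G (t - d - real i * d)) = G t - G (t - l a)" for a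
    proof -
      have "(\<Sum>i<m a. G (t - real i * d)) - (\<Sum>i<m a. G (t - d - real i * d))
        = (\<Sum>i<m a. G (t - real i * d) - G (t - real (Suc i) * d))"
        by (simp add: sum_subtractf algebra_simps)
      also have "\<dots> = G t - G (t - l a)" by (subst sum_lessThan_telescope') (simp add: m)
      finally show ?thesis .
    qed
    then have "K t - K (t - d) = (\<Sum>a\<in>UNIV. p a * (G t - G (t - l a)))"
      by (simp add: K_def sum_subtractf[symmetric] right_diff_distrib[symmetric])
    also have "\<dots> = g t"
      by (rule sum_increments)
    finally show ?thesis .
  qed
  have K_bound: "K t \<le> \<mu> * B" for t
  proof -
    have "(\<Sum>i<m a. G (t - real i * d)) \<le> real (m a) * B" for a
      using sum_mono[of "{..<m a}" "\<lambda>i. G (t - real i * d)" "\<lambda>_. B"] bounded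
      by (auto simp: abs_le_iff)
    then have "K t \<le> (\<Sum>a\<in>UNIV. p a * (real (m a) * B))"
      unfolding K_def using p_pos by (intro sum_mono mult_left_mono) (auto intro: less_imp_le)
    then show ?thesis by (simp add: \<mu>_def sum_distrib_right mult.assoc)
  qed
  have K_conv: "convergent (\<lambda>k. K (t + real k * d))" for t
  proof -
    have "incseq (\<lambda>k. K (t + real k * d))"
    proof (rule incseq_SucI)
      fix k show "K (t + real k * d) \<le> K (t + real (Suc k) * d)"
        using K_step[of "t + real (Suc k) * d"] g_nonneg[of "t + real (Suc k) * d"]
        by (simp add: algebra_simps)
    qed
    then obtain z where "(\<lambda>k. K (t + real k * d)) \<longlonglongrightarrow> z"
      by (rule incseq_convergent[of "\<lambda>k. K (t + real k * d)" "\<mu> * B"]) (use K_bound in auto)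
    then show ?thesis by (auto simp: convergent_def)
  qed
  have "((\<lambda>t. \<Sum>a\<in>UNIV. p a * (\<Sum>i<m a. G t - G (t - real i * d)))
      \<longlongrightarrow> (\<Sum>a\<in>(UNIV::'a set). p a * (\<Sum>i<m a. 0))) at_top"
    using asymptotic_period_nat_mult[OF period] unfolding asymptotic_period_def
    by (intro tendsto_intros)
  also have "(\<lambda>t. \<Sum>a\<in>UNIV. p a * (\<Sum>i<m a. G t - G (t - real i * d))) = (\<lambda>t. \<mu> * G t - K t)"
    by (simp add: K_def \<mu>_def sum_subtractf right_diff_distrib sum_distrib_right mult.assoc)
  finally have KG: "((\<lambda>t. \<mu> * G t - K t) \<longlongrightarrow> 0) at_top" by simp
  have at: "filterlim (\<lambda>k. t + real k * d) at_top sequentially" for t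
    using d by real_asymp
  have G_conv: "convergent (\<lambda>k. G (t + real k * d))" for t
  proof -
    obtain z where "(\<lambda>k. K (t + real k * d)) \<longlonglongrightarrow> z" using K_conv by (auto simp: convergent_def)
    then have "(\<lambda>k. ((\<mu> * G (t + real k * d) - K (t + real k * d)) + K (t + real k * d)) / \<mu>)
        \<longlonglongrightarrow> (0 + z) / \<mu>"
      using \<mu> by (intro tendsto_divide tendsto_add filterlim_compose[OF KG at] tendsto_const) auto
    then show ?thesis using \<mu> by (auto simp: convergent_def)
  qed
  define H where "H t = lim (\<lambda>k. G (t + real k * d))" for t
  have GH: "(\<lambda>k. G (t + real k * d)) \<longlonglongrightarrow> H t" for t
    using G_conv unfolding H_def convergent_LIMSEQ_iff .
  have H_lip: "\<bar>H t - H s\<bar> \<le> L * \<bar>t - s\<bar>" for s t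
  proof (rule LIMSEQ_le_const2)
    show "(\<lambda>k. \<bar>G (t + real k * d) - G (s + real k * d)\<bar>) \<longlonglongrightarrow> \<bar>H t - H s\<bar>"
      by (intro tendsto_intros GH)
    show "\<exists>N. \<forall>n\<ge>N. \<bar>G (t + real n * d) - G (s + real n * d)\<bar> \<le> L * \<bar>t - s\<bar>"
    proof (intro exI allI impI)
      fix n show "\<bar>G (t + real n * d) - G (s + real n * d)\<bar> \<le> L * \<bar>t - s\<bar>"
        using lipschitz[of "t + real n * d" "s + real n * d"] by simp
    qed
  qed
  have "L-lipschitz_on UNIV H"
    using H_lip L_nonneg by (intro lipschitz_onI) (auto simp: dist_real_def)
  then have H_cont: "continuous_on UNIV H" by (rule lipschitz_on_continuous_on)
  have H_per: "H (t + d) = H t" for t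
  proof (rule LIMSEQ_unique)
    show "(\<lambda>k. G ((t + d) + real k * d)) \<longlonglongrightarrow> H (t + d)" by (rule GH)
    show "(\<lambda>k. G ((t + d) + real k * d)) \<longlonglongrightarrow> H t"
      using LIMSEQ_Suc[OF GH[of t]] by (simp add: algebra_simps)
  qed
  have H_per': "H (t + real k * d) = H t" for t k
    by (induction k) (use H_per[of "t + real _ * d"] in \<open>auto simp: algebra_simps\<close>)
  have lim: "((\<lambda>t. G t - H t) \<longlongrightarrow> 0) at_top"
  proof (rule lipschitz_lattice_tendsto[OF _ d])
    show "\<bar>(G t - H t) - (G s - H s)\<bar> \<le> (2 * L) * \<bar>t - s\<bar>" for s t
      using lipschitz[of t s] H_lip[of t s] by linarith
    show "(\<lambda>k. G (t + real k * d) - H (t + real k * d)) \<longlonglongrightarrow> 0" for t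
      using tendsto_diff[OF GH[of t] tendsto_const[of "H t"]] by (simp add: H_per')
  qed
  obtain \<Gamma> where \<Gamma>: "\<And>t. (\<Gamma> has_real_derivative G t) (at t)"
    using continuous_antiderivative[OF continuous_G] by blast
  obtain \<Lambda> where \<Lambda>: "\<And>t. (\<Lambda> has_real_derivative H t) (at t)"
    using continuous_antiderivative[OF H_cont] by blast
  define v where "v = \<Lambda> d - \<Lambda> 0"
  have v: "integral {0..d} H = v"
    unfolding v_def using d \<Lambda>
    by (intro integral_unique fundamental_theorem_of_calculus)
      (auto simp: has_real_derivative_iff_has_vector_derivative[symmetric]
         intro: has_field_derivative_at_within)
  have step: "\<Lambda> t - \<Lambda> (t - d) = v" for t
  proof -
    have "((\<lambda>t. \<Lambda> t - \<Lambda> (t - d)) has_real_derivative 0) (at t)" for t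
    proof -
      have "((\<lambda>t. \<Lambda> t - \<Lambda> (t - d)) has_real_derivative H t - H (t - d)) (at t)"
        using \<Lambda>[of "t - d"] DERIV_shift[of \<Lambda> "H (t - d)" t "- d"] \<Lambda>[of t]
        by (intro derivative_intros) auto
      then show ?thesis using H_per[of "t - d"] by simp
    qed
    then have "\<Lambda> t - \<Lambda> (t - d) = \<Lambda> d - \<Lambda> (d - d)"
      using DERIV_isconst_all[of "\<lambda>t. \<Lambda> t - \<Lambda> (t - d)"] by blast
    then show ?thesis by (simp add: v_def)
  qed
  have steps: "\<Lambda> t - \<Lambda> (t - real k * d) = real k * v" for t k
  proof (induction k)
    case (Suc k)
    then show ?case using step[of "t - real k * d"] by (simp add: algebra_simps)
  qed simp
  have diff: "((\<lambda>t. (\<Gamma> t - \<Lambda> t) - (\<Gamma> (t - l a) - \<Lambda> (t - l a))) \<longlongrightarrow> 0) at_top" for a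
    by (rule antiderivative_increment_tendsto_0[OF _ l_pos lim]) (intro derivative_intros \<Gamma> \<Lambda>)
  have "((\<lambda>t. I t - (\<Sum>a\<in>UNIV. p a * ((\<Gamma> t - \<Lambda> t) - (\<Gamma> (t - l a) - \<Lambda> (t - l a)))))
      \<longlongrightarrow> c - (\<Sum>a\<in>(UNIV::'a set). p a * 0)) at_top"
    by (intro tendsto_intros I_top diff)
  also have "(\<lambda>t. I t - (\<Sum>a\<in>UNIV. p a * ((\<Gamma> t - \<Lambda> t) - (\<Gamma> (t - l a) - \<Lambda> (t - l a)))))
      = (\<lambda>_. \<mu> * v)"
  proof
    fix t
    have "I t - (\<Sum>a\<in>UNIV. p a * ((\<Gamma> t - \<Lambda> t) - (\<Gamma> (t - l a) - \<Lambda> (t - l a))))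
      = (\<Sum>a\<in>UNIV. p a * (\<Lambda> t - \<Lambda> (t - l a)))"
      unfolding mass_balance[OF \<Gamma>, of t, symmetric] sum_subtractf[symmetric]
      by (simp add: algebra_simps)
    also have "\<dots> = \<mu> * v" by (simp add: m steps \<mu>_def sum_distrib_right mult.assoc)
    finally show "I t - (\<Sum>a\<in>UNIV. p a * ((\<Gamma> t - \<Lambda> t) - (\<Gamma> (t - l a) - \<Lambda> (t - l a)))) = \<mu> * v" .
  qed
  finally have "\<mu> * v = c" by (simp add: tendsto_const_iff)
  then have "integral {0..d} H = d * (c / mean_step)" using v \<mu> d by (simp add: field_simps)
  then show ?thesis using that H_cont H_per lim by blast
qed

text \<open>
  A renewal theorem that treats the non-lattice and the lattice case together: in the former \<open>H\<close> is
  constant and \<open>d\<close> is arbitrary.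
\<close>

theorem renewal_limit:
  obtains H d where "d > 0" "continuous_on UNIV H" "\<And>t. H (t + d) = H t"
    "integral {0..d} H = d * (c / mean_step)" "((\<lambda>t. G t - H t) \<longlongrightarrow> 0) at_top"
    "(\<forall>t. H t = c / mean_step) \<or> (\<forall>a. \<exists>k::int. l a = of_int k * d)"
proof -
  obtain a :: 'a where True by simp
  from asymptotic_period_step[of a] l_pos[of a] show ?thesis
  proof (cases rule: asymptotic_periods_dichotomy)
    case dense
    have "((\<lambda>t. G t - c / mean_step) \<longlongrightarrow> c / mean_step - c / mean_step) at_top"
      by (intro tendsto_diff tendsto_dense dense tendsto_const)
    then show ?thesis using that[of 1 "\<lambda>_. c / mean_step"] by simp
  next
    case (lattice d)
    have steps: "\<exists>k::int. l a = of_int k * d" for a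
      using lattice asymptotic_period_step by blast
    from tendsto_lattice[OF lattice(1,2) this] show ?thesis
      using that lattice(1) steps by blast
  qed
qed

end

section \<open>Sums over words\<close>

text \<open>
  The common dominating function for all sums over words. It is small both for words that are too
  likely and for words that are too unlikely to matter at scale \<open>x\<close>, and it is the derivative of
  \<open>x / (1 + x)\<close> with respect to \<open>ln x\<close>.
\<close>

definition bump :: "real \<Rightarrow> real" where "bump x = x / (1 + x)\<^sup>2"

lemma bump_nonneg: "x \<ge> 0 \<Longrightarrow> bump x \<ge> 0"
  by (simp add: bump_def)

definition word_prob :: "('a \<Rightarrow> real) \<Rightarrow> 'a list \<Rightarrow> real" where
  "word_prob p w = (\<Prod>a\<leftarrow>w. p a)"

lemma word_prob_simps [simp]:
  "word_prob p [] = 1" "word_prob p (a # w) = p a * word_prob p w"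
  "word_prob p (u @ w) = word_prob p u * word_prob p w"
  by (simp_all add: word_prob_def)

definition word_sum :: "('a \<Rightarrow> real) \<Rightarrow> (real \<Rightarrow> real) \<Rightarrow> real \<Rightarrow> real" where
  "word_sum p f x = (\<Sum>\<^sub>\<infinity>w. word_prob p w * f (x * word_prob p w))"

locale letter_probs =
  fixes p :: "'a::finite \<Rightarrow> real"
  assumes two_letters: "CARD('a) \<ge> 2" and p_pos: "p a > 0" and p_sum: "(\<Sum>a\<in>UNIV. p a) = 1"
begin

lemma p_less_1: "p a < 1"
proof -
  have "UNIV \<noteq> {a}"
  proof
    assume "UNIV = {a}"
    then have "CARD('a) = card {a}" by (simp only:)
    then show False using two_letters by simp
  qed
  then have "UNIV - {a} \<noteq> {}" by auto
  then have "(\<Sum>b\<in>UNIV - {a}. p b) > 0" using p_pos by (intro sum_pos) auto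
  then show ?thesis using p_sum sum.remove[of UNIV a p] by simp
qed

lemma word_prob_pos: "word_prob p w > 0"
  by (induction w) (use p_pos in auto)

lemma word_prob_le_1: "word_prob p w \<le> 1"
proof (induction w)
  case (Cons a w)
  then show ?case
    using p_less_1[of a] p_pos[of a] word_prob_pos[of w] by (auto intro: mult_le_one)
qed simp

text \<open>The probability that two independent letters differ.\<close>

definition decay :: real where "decay = (\<Sum>a\<in>UNIV. p a * (1 - p a))"

lemma decay_pos: "decay > 0"
  unfolding decay_def using p_pos p_less_1 by (intro sum_pos) auto

text \<open>
  The function \<open>x / (1 + x)\<close> exceeds the \<open>p\<close>-weighted mean of its values at \<open>p a * x\<close> by a multiple of
  \<open>bump\<close>. It therefore bounds, by induction on the length, the sum of \<open>bump\<close> over all shorter words.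
\<close>

lemma supersolution:
  assumes x: "x \<ge> 0"
  shows "decay * bump x + (\<Sum>a\<in>UNIV. p a * (p a * x / (1 + p a * x))) \<le> x / (1 + x)"
proof -
  have "p a * (1 - p a) * bump x + p a * (p a * x / (1 + p a * x)) \<le> p a * (x / (1 + x))" for a
  proof -
    have pa: "0 < p a" "p a < 1" using p_pos p_less_1 by auto
    then have "p a * x \<le> x" "p a * x \<ge> 0" using x by (auto intro: mult_left_le_one_le)
    then have pos: "1 + x > 0" "1 + p a * x > 0" "p a * x \<le> x" using x by linarith+
    have "x / (1 + x) - p a * x / (1 + p a * x) = (1 - p a) * x / ((1 + x) * (1 + p a * x))"
      using pos by (simp add: field_simps)
    also have "\<dots> \<ge> (1 - p a) * x / ((1 + x) * (1 + x))"
      using pos pa x by (intro divide_left_mono mult_left_mono) auto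
    also have "(1 - p a) * x / ((1 + x) * (1 + x)) = (1 - p a) * bump x"
      by (simp add: bump_def power2_eq_square)
    finally have "(1 - p a) * bump x + p a * x / (1 + p a * x) \<le> x / (1 + x)" by simp
    then have "p a * ((1 - p a) * bump x + p a * x / (1 + p a * x)) \<le> p a * (x / (1 + x))"
      using pa by (intro mult_left_mono) auto
    then show ?thesis by (simp add: algebra_simps)
  qed
  then have "(\<Sum>a\<in>UNIV. p a * (1 - p a) * bump x + p a * (p a * x / (1 + p a * x)))
      \<le> (\<Sum>a\<in>UNIV. p a * (x / (1 + x)))"
    by (rule sum_mono)
  also have "\<dots> = x / (1 + x)" by (simp only: sum_distrib_right[symmetric] p_sum mult_1)
  finally show ?thesis
    by (simp add: decay_def sum.distrib sum_distrib_right)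
qed

lemma finite_words_shorter: "finite {w::'a list. length w < N}"
proof (rule finite_subset)
  show "{w::'a list. length w < N} \<subseteq> {w. set w \<subseteq> UNIV \<and> length w \<le> N}" by auto
qed (rule finite_lists_length_le, simp)

lemma sum_words_shorter_Suc:
  "(\<Sum>w | length w < Suc N. f w) = f [] + (\<Sum>a\<in>UNIV. \<Sum>w | length w < N. f (a # w :: 'a list))"
proof -
  have "{w::'a list. length w < Suc N} = insert [] ((\<lambda>(a, w). a # w) ` (UNIV \<times> {w. length w < N}))"
    (is "_ = insert [] ?A")
  proof (rule set_eqI)
    fix w :: "'a list"
    show "w \<in> {w. length w < Suc N} \<longleftrightarrow> w \<in> insert [] ?A" by (cases w) auto
  qed
  then have "(\<Sum>w | length w < Suc N. f w) = (\<Sum>w\<in>insert [] ?A. f w)" by simp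
  also have "\<dots> = f [] + sum f ?A"
    by (rule sum.insert) (auto intro!: finite_imageI finite_cartesian_product finite_words_shorter)
  also have "sum f ?A = (\<Sum>(a, w)\<in>UNIV \<times> {w. length w < N}. f (a # w))"
    by (subst sum.reindex) (auto simp: inj_on_def intro!: sum.cong)
  also have "\<dots> = (\<Sum>a\<in>UNIV. \<Sum>w | length w < N. f (a # w))"
    by (simp add: sum.cartesian_product)
  finally show ?thesis .
qed

lemma bump_sum_shorter:
  "x \<ge> 0 \<Longrightarrow> (\<Sum>w | length w < N. word_prob p w * bump (x * word_prob p w)) \<le> x / (1 + x) / decay"
proof (induction N arbitrary: x)
  case 0
  then show ?case using decay_pos by simp
next
  case (Suc N)
  let ?S = "\<lambda>x. \<Sum>w | length w < N. word_prob p w * bump (x * word_prob p w)"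
  have "(\<Sum>w | length w < Suc N. word_prob p w * bump (x * word_prob p w))
      = bump x + (\<Sum>a\<in>UNIV. p a * ?S (p a * x))"
    by (simp add: sum_words_shorter_Suc sum_distrib_left mult_ac)
  also have "\<dots> \<le> bump x + (\<Sum>a\<in>UNIV. p a * (p a * x / (1 + p a * x) / decay))"
    using Suc.prems less_imp_le[OF p_pos]
    by (intro add_left_mono sum_mono mult_left_mono Suc.IH) auto
  also have "\<dots> = (decay * bump x + (\<Sum>a\<in>UNIV. p a * (p a * x / (1 + p a * x)))) / decay"
    using decay_pos by (simp add: add_divide_distrib sum_divide_distrib)
  also have "\<dots> \<le> x / (1 + x) / decay"
    using supersolution[OF Suc.prems] decay_pos by (intro divide_right_mono) auto
  finally show ?case .
qed

lemma bump_sum_le: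
  assumes "x \<ge> 0" "finite W"
  shows "(\<Sum>w\<in>W. word_prob p w * bump (x * word_prob p w)) \<le> x / (1 + x) / decay"
proof -
  obtain N where N: "W \<subseteq> {w. length w < N}"
  proof
    show "W \<subseteq> {w. length w < Suc (Max (length ` W))}"
      using assms(2) by (auto simp: less_Suc_eq_le)
  qed
  have "(\<Sum>w\<in>W. word_prob p w * bump (x * word_prob p w))
      \<le> (\<Sum>w | length w < N. word_prob p w * bump (x * word_prob p w))"
    using N assms(1) less_imp_le[OF word_prob_pos]
    by (intro sum_mono2 finite_words_shorter) (auto intro!: mult_nonneg_nonneg bump_nonneg)
  then show ?thesis using bump_sum_shorter[OF assms(1), of N] by linarith
qed

lemma dominated_sum_le:
  assumes x: "x \<ge> 0" and C: "C \<ge> 0"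
    and f: "\<And>w. \<bar>f w\<bar> \<le> C * (word_prob p w * bump (x * word_prob p w))" and "finite W"
  shows "(\<Sum>w\<in>W. \<bar>f w\<bar>) \<le> C * (x / (1 + x)) / decay"
proof -
  have "(\<Sum>w\<in>W. \<bar>f w\<bar>) \<le> C * (\<Sum>w\<in>W. word_prob p w * bump (x * word_prob p w))"
    unfolding sum_distrib_left by (intro sum_mono f)
  also have "\<dots> \<le> C * (x / (1 + x) / decay)"
    using bump_sum_le[OF x \<open>finite W\<close>] C by (intro mult_left_mono)
  finally show ?thesis by simp
qed

lemma dominated_abs_summable:
  assumes "x \<ge> 0" "C \<ge> 0"
    and "\<And>w. \<bar>f w\<bar> \<le> C * (word_prob p w * bump (x * word_prob p w))"
  shows "(\<lambda>w. \<bar>f w\<bar>) summable_on UNIV"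
proof (rule nonneg_bdd_above_summable_on)
  show "bdd_above (sum (\<lambda>w. \<bar>f w\<bar>) ` {F. F \<subseteq> UNIV \<and> finite F})"
  proof (rule bdd_aboveI2)
    fix F :: "'a list set"
    assume "F \<in> {F. F \<subseteq> UNIV \<and> finite F}"
    then have "finite F" by simp
    show "(\<Sum>w\<in>F. \<bar>f w\<bar>) \<le> C * (x / (1 + x)) / decay"
      by (rule dominated_sum_le[where f = f, OF assms(1) assms(2) assms(3) \<open>finite F\<close>])
  qed
qed simp

lemma dominated_summable:
  assumes "x \<ge> 0" "C \<ge> 0"
    and "\<And>w. \<bar>f w\<bar> \<le> C * (word_prob p w * bump (x * word_prob p w))"
  shows "f summable_on UNIV"
  by (rule abs_summable_summable) (use dominated_abs_summable[OF assms] in simp)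

lemma dominated_infsum_le:
  assumes "x \<ge> 0" "C \<ge> 0"
    and "\<And>w. \<bar>f w\<bar> \<le> C * (word_prob p w * bump (x * word_prob p w))"
  shows "\<bar>\<Sum>\<^sub>\<infinity>w. f w\<bar> \<le> C * (x / (1 + x)) / decay"
proof -
  have "\<bar>\<Sum>\<^sub>\<infinity>w. f w\<bar> \<le> (\<Sum>\<^sub>\<infinity>w. \<bar>f w\<bar>)"
    using norm_infsum_bound[of f UNIV] dominated_abs_summable[OF assms] by simp
  also have "\<dots> \<le> C * (x / (1 + x)) / decay"
    by (rule infsum_le_finite_sums[OF dominated_abs_summable[OF assms] dominated_sum_le[OF assms]])
  finally show ?thesis .
qed

text \<open>
  A factor \<open>x / (1 + x)\<close> is kept in the bound: it gives boundedness in \<open>x\<close> and also the decay as \<open>x\<close>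
  tends to \<open>0\<close>.
\<close>

lemma word_sum_summable:
  assumes f: "\<And>x. x \<ge> 0 \<Longrightarrow> \<bar>f x\<bar> \<le> C * bump x" and x: "x \<ge> 0"
  shows "(\<lambda>w. word_prob p w * f (x * word_prob p w)) summable_on UNIV"
    and "\<bar>word_sum p f x\<bar> \<le> C * (x / (1 + x)) / decay"
proof -
  have "C * bump 1 \<ge> 0" using f[of 1] by (smt (verit) zero_le_one abs_ge_zero)
  then have C: "C \<ge> 0" by (simp add: bump_def)
  have "\<bar>word_prob p w * f (x * word_prob p w)\<bar> \<le> C * (word_prob p w * bump (x * word_prob p w))" for w
    using f[of "x * word_prob p w"] x word_prob_pos[of w]
    by (simp add: abs_mult mult.left_commute)
  from dominated_summable[OF x C this] dominated_infsum_le[OF x C this]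
  show "(\<lambda>w. word_prob p w * f (x * word_prob p w)) summable_on UNIV"
    and "\<bar>word_sum p f x\<bar> \<le> C * (x / (1 + x)) / decay"
    by (simp_all add: word_sum_def)
qed

text \<open>Every word is empty or has a first letter \<open>a\<close>, which rescales the argument by \<open>p a\<close>.\<close>

lemma word_sum_renewal:
  assumes f: "\<And>x. x \<ge> 0 \<Longrightarrow> \<bar>f x\<bar> \<le> C * bump x" and x: "x \<ge> 0"
  shows "word_sum p f x = f x + (\<Sum>a\<in>UNIV. p a * word_sum p f (p a * x))"
proof -
  let ?h = "\<lambda>w. word_prob p w * f (x * word_prob p w)"
  have "(?h has_sum (p a * word_sum p f (p a * x))) (Cons a ` UNIV)" for a
  proof -
    have "p a * x \<ge> 0" using x p_pos[of a] by simp
    then have "((\<lambda>w. word_prob p w * f (p a * x * word_prob p w)) has_sum word_sum p f (p a * x)) UNIV"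
      unfolding word_sum_def using f by (intro has_sum_infsum word_sum_summable(1)) auto
    then have "((\<lambda>w. p a * (word_prob p w * f (p a * x * word_prob p w)))
        has_sum (p a * word_sum p f (p a * x))) UNIV"
      by (rule has_sum_cmult_right)
    then show ?thesis by (subst has_sum_reindex) (auto simp: o_def mult_ac)
  qed
  then have "(?h has_sum (\<Sum>a\<in>UNIV. p a * word_sum p f (p a * x))) (\<Union>a\<in>UNIV. Cons a ` UNIV)"
    by (intro sum_has_sum) auto
  then have "(?h has_sum (?h [] + (\<Sum>a\<in>UNIV. p a * word_sum p f (p a * x))))
      (insert [] (\<Union>a\<in>UNIV. Cons a ` UNIV))"
    by (intro has_sum_insert) auto
  also have "insert [] (\<Union>a\<in>UNIV. Cons a ` UNIV) = (UNIV :: 'a list set)"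
  proof -
    have "w \<in> insert [] (\<Union>a\<in>UNIV. Cons a ` UNIV)" for w :: "'a list" by (cases w) auto
    then show ?thesis by blast
  qed
  finally show ?thesis unfolding word_sum_def by (auto dest: infsumI)
qed

text \<open>
  The derivative of \<open>f(e^t)\<close> with respect to \<open>t\<close> is \<open>x * f' x\<close> at \<open>x = e^t\<close>, again dominated by
  \<open>bump\<close>. Differentiating finite partial sums only, and passing to the limit in the resulting
  Lipschitz bound, avoids termwise differentiation of the infinite sum.
\<close>

lemma word_sum_exp_lipschitz:
  assumes f: "\<And>x. x \<ge> 0 \<Longrightarrow> \<bar>f x\<bar> \<le> C * bump x"
    and f': "\<And>x. x > 0 \<Longrightarrow> (f has_real_derivative f' x) (at x)"
    and xf': "\<And>x. x > 0 \<Longrightarrow> \<bar>x * f' x\<bar> \<le> D * bump x"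
  shows "\<bar>word_sum p f (exp t) - word_sum p f (exp s)\<bar> \<le> D / decay * \<bar>t - s\<bar>"
proof -
  have "D * bump 1 \<ge> 0" using xf'[of 1] by (smt (verit) zero_less_one abs_ge_zero)
  then have D: "D \<ge> 0" by (simp add: bump_def)
  have fin: "\<bar>(\<Sum>w\<in>W. word_prob p w * f (exp t * word_prob p w))
      - (\<Sum>w\<in>W. word_prob p w * f (exp s * word_prob p w))\<bar> \<le> D / decay * \<bar>t - s\<bar>"
    if W: "finite W" for W
  proof -
    define S where "S u = (\<Sum>w\<in>W. word_prob p w * f (exp u * word_prob p w))" for u
    define S' where
      "S' u = (\<Sum>w\<in>W. word_prob p w * (f' (exp u * word_prob p w) * (exp u * word_prob p w)))" for u
    have der: "(S has_real_derivative S' u) (at u)" for u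
    proof -
      have "((\<lambda>u. f (exp u * word_prob p w)) has_real_derivative
          f' (exp u * word_prob p w) * (exp u * word_prob p w)) (at u)" for w
        using word_prob_pos[of w]
        by (intro DERIV_chain2[of f] f') (auto intro!: derivative_eq_intros)
      then show ?thesis unfolding S_def S'_def by (intro DERIV_sum DERIV_cmult)
    qed
    have "\<bar>S' u\<bar> \<le> D / decay" for u
    proof -
      have "\<bar>S' u\<bar> \<le> (\<Sum>w\<in>W. \<bar>word_prob p w * (f' (exp u * word_prob p w) * (exp u * word_prob p w))\<bar>)"
        unfolding S'_def by (rule sum_abs)
      also have "\<dots> \<le> D * (exp u / (1 + exp u)) / decay"
      proof (rule dominated_sum_le[OF _ D _ W])
        fix w
        show "\<bar>word_prob p w * (f' (exp u * word_prob p w) * (exp u * word_prob p w))\<bar>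
            \<le> D * (word_prob p w * bump (exp u * word_prob p w))"
          using xf'[of "exp u * word_prob p w"] word_prob_pos[of w]
          by (simp add: abs_mult mult_ac)
      qed auto
      also have "\<dots> \<le> D * 1 / decay"
        using D decay_pos
        by (intro divide_right_mono mult_left_mono) (auto simp: field_simps add_pos_pos)
      finally show ?thesis by simp
    qed
    then have "norm (S t - S s) \<le> D / decay * norm (t - s)"
      using der by (intro field_differentiable_bound[of UNIV S S']) (auto intro: has_field_derivative_at_within)
    then show ?thesis by (simp add: S_def)
  qed
  have "((\<lambda>w. word_prob p w * f (exp u * word_prob p w)) has_sum word_sum p f (exp u)) UNIV" for u
    unfolding word_sum_def using f by (intro has_sum_infsum word_sum_summable(1)) auto
  note sums = this[unfolded has_sum_def]
  show ?thesis
  proof (rule tendsto_upperbound)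
    show "((\<lambda>W. \<bar>(\<Sum>w\<in>W. word_prob p w * f (exp t * word_prob p w))
      - (\<Sum>w\<in>W. word_prob p w * f (exp s * word_prob p w))\<bar>) \<longlongrightarrow>
       \<bar>word_sum p f (exp t) - word_sum p f (exp s)\<bar>) (finite_subsets_at_top UNIV)"
      by (intro tendsto_intros sums)
    show "\<forall>\<^sub>F W in finite_subsets_at_top UNIV. \<bar>(\<Sum>w\<in>W. word_prob p w * f (exp t * word_prob p w))
      - (\<Sum>w\<in>W. word_prob p w * f (exp s * word_prob p w))\<bar> \<le> D / decay * \<bar>t - s\<bar>"
      using fin by (auto simp: eventually_finite_subsets_at_top)
  qed simp
qed

end

section \<open>The Poisson profile\<close>

lemma power_le_fact_exp:
  fixes x :: real
  assumes "x \<ge> 0"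
  shows "x ^ m \<le> fact m * exp x"
proof -
  have "(\<Sum>n\<in>{m}. x ^ n /\<^sub>R fact n) \<le> (\<Sum>n. x ^ n /\<^sub>R fact n)"
    using assms by (intro sum_le_suminf summable_exp_generic) auto
  then have "x ^ m / fact m \<le> exp x" by (simp add: exp_def divide_inverse mult.commute)
  then show ?thesis by (simp add: field_simps)
qed

definition bump_const :: "nat \<Rightarrow> real" where "bump_const j = fact (j + 2) * exp 1"

lemma power_exp_le_bump:
  assumes "x \<ge> 0"
  shows "x ^ (j + 1) * exp (- x) \<le> bump_const j * bump x"
proof -
  have "x ^ j * (1 + x)\<^sup>2 \<le> (1 + x) ^ j * (1 + x)\<^sup>2"
    using assms by (intro mult_right_mono power_mono) auto
  also have "\<dots> = (1 + x) ^ (j + 2)" by (simp add: power_add power2_eq_square)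
  also have "\<dots> \<le> fact (j + 2) * exp (1 + x)"
    using assms by (intro power_le_fact_exp) auto
  also have "\<dots> = bump_const j * exp x" by (simp add: bump_const_def exp_add)
  finally have "x ^ j * (1 + x)\<^sup>2 * exp (- x) \<le> bump_const j * exp x * exp (- x)"
    by (intro mult_right_mono) auto
  then have "x ^ j * exp (- x) \<le> bump_const j / (1 + x)\<^sup>2"
    using assms by (simp add: exp_minus field_simps)
  then have "x * (x ^ j * exp (- x)) \<le> x * (bump_const j / (1 + x)\<^sup>2)"
    using assms by (intro mult_left_mono)
  then show ?thesis by (simp add: bump_def mult_ac)
qed

text \<open>
  For a motif of size \<open>\<tau> = k + 2\<close>, \<open>x * profile k x\<close> is the probability that a Poisson variable of
  mean \<open>x\<close> equals \<open>\<tau>\<close>. The factor \<open>x\<close> is split off because \<open>x = n * P(w)\<close> supplies the weight \<open>P(w)\<close>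
  of the word and the factor \<open>n\<close> of the expectation.
\<close>

definition profile :: "nat \<Rightarrow> real \<Rightarrow> real" where
  "profile k x = x ^ (k + 1) * exp (- x) / fact (k + 2)"

lemma profile_nonneg: "x \<ge> 0 \<Longrightarrow> profile k x \<ge> 0"
  by (simp add: profile_def)

lemma profile_le_bump: "x \<ge> 0 \<Longrightarrow> \<bar>profile k x\<bar> \<le> bump_const k / fact (k + 2) * bump x"
  using power_exp_le_bump[of x k] by (simp add: profile_def divide_right_mono)

definition profile_deriv :: "nat \<Rightarrow> real \<Rightarrow> real" where
  "profile_deriv k x = (real (k + 1) * x ^ k - x ^ (k + 1)) * exp (- x) / fact (k + 2)"

lemma profile_has_derivative: "(profile k has_real_derivative profile_deriv k x) (at x)"
  unfolding profile_def[abs_def] profile_deriv_def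
  by (rule derivative_eq_intros refl | simp add: field_simps del: fact_Suc)+

lemma profile_deriv_le_bump:
  assumes "x \<ge> 0"
  shows "\<bar>x * profile_deriv k x\<bar>
    \<le> (real (k + 1) * bump_const k + bump_const (k + 1)) / fact (k + 2) * bump x"
proof -
  have "x * profile_deriv k x
      = (real (k + 1) * (x ^ (k + 1) * exp (- x)) - x ^ (k + 1 + 1) * exp (- x)) / fact (k + 2)"
    by (simp add: profile_deriv_def algebra_simps del: fact_Suc)
  also have "\<bar>\<dots>\<bar> \<le> (real (k + 1) * (x ^ (k + 1) * exp (- x)) + x ^ (k + 1 + 1) * exp (- x)) / fact (k + 2)"
  proof -
    have "\<bar>u - v\<bar> / d \<le> (u + v) / d" if "u \<ge> 0" "v \<ge> 0" "d > 0" for u v d :: real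
      using that by (intro divide_right_mono) auto
    from this[of "real (k + 1) * (x ^ (k + 1) * exp (- x))" "x ^ (k + 1 + 1) * exp (- x)" "fact (k + 2)"]
    show ?thesis using assms by (simp add: abs_divide del: fact_Suc)
  qed
  also have "\<dots> \<le> (real (k + 1) * (bump_const k * bump x) + bump_const (k + 1) * bump x) / fact (k + 2)"
    using assms by (intro divide_right_mono add_mono mult_left_mono power_exp_le_bump) auto
  finally show ?thesis by (simp add: algebra_simps)
qed

text \<open>
  The integral of \<open>profile k u / u\<close> for \<open>u\<close> from \<open>0\<close> to \<open>x\<close>: up to the factor
  \<open>1 / ((k + 2) * (k + 1))\<close> it is the distribution function of a Gamma variable of shape \<open>k + 1\<close>.
  This is where the constant \<open>1 / (\<tau> * (\<tau> - 1))\<close> comes from.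
\<close>

definition profile_mass :: "nat \<Rightarrow> real \<Rightarrow> real" where
  "profile_mass k x = (1 - exp (- x) * (\<Sum>i\<le>k. x ^ i / fact i)) / (real (k + 2) * real (k + 1))"

lemma exp_partial_sum_has_derivative:
  "((\<lambda>x::real. exp (- x) * (\<Sum>i\<le>k. x ^ i / fact i)) has_real_derivative
     - (exp (- x) * (x ^ k / fact k))) (at x)"
proof (induction k)
  case 0
  then show ?case by (auto intro!: derivative_eq_intros)
next
  case (Suc k)
  have "((\<lambda>x::real. exp (- x) * (x ^ Suc k / fact (Suc k))) has_real_derivative
      exp (- x) * (x ^ k / fact k) - exp (- x) * (x ^ Suc k / fact (Suc k))) (at x)"
  proof -
    have "((\<lambda>x::real. x ^ Suc k / fact (Suc k)) has_real_derivative
        real (Suc k) * x ^ k / fact (Suc k)) (at x)"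
      using DERIV_pow[of "Suc k" x] by (intro DERIV_cdivide) simp
    also have "real (Suc k) * x ^ k / fact (Suc k) = x ^ k / fact k"
      unfolding fact_Suc[of k] by (simp del: of_nat_Suc)
    finally have pow: "((\<lambda>x::real. x ^ Suc k / fact (Suc k)) has_real_derivative
        x ^ k / fact k) (at x)" .
    have "((\<lambda>x::real. exp (- x)) has_real_derivative - exp (- x)) (at x)"
      by (auto intro!: derivative_eq_intros)
    from DERIV_mult[OF this pow] show ?thesis
      by (simp add: mult.commute del: fact_Suc power_Suc)
  qed
  from DERIV_add[OF Suc this] show ?case
    by (simp add: distrib_left del: fact_Suc power_Suc)
qed

lemma profile_mass_has_derivative:
  "((\<lambda>t. profile_mass k (exp t)) has_real_derivative profile k (exp t)) (at t)"
proof -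
  have "(profile_mass k has_real_derivative
      (0 - - (exp (- x) * (x ^ k / fact k))) / (real (k + 2) * real (k + 1))) (at x)" for x
    unfolding profile_mass_def[abs_def]
    by (intro DERIV_cdivide DERIV_diff DERIV_const exp_partial_sum_has_derivative)
  then have "((\<lambda>t. profile_mass k (exp t)) has_real_derivative
      (0 - - (exp (- exp t) * (exp t ^ k / fact k))) / (real (k + 2) * real (k + 1)) * exp t) (at t)"
    by (rule DERIV_chain2) (auto intro!: derivative_eq_intros)
  also have "(0 - - (exp (- exp t) * (exp t ^ k / fact k))) / (real (k + 2) * real (k + 1)) * exp t
      = profile k (exp t)"
    by (simp add: profile_def mult_ac)
  finally show ?thesis .
qed

lemma profile_mass_bot: "((\<lambda>t. profile_mass k (exp t)) \<longlongrightarrow> 0) at_bot"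
proof -
  have "isCont (profile_mass k) 0"
    unfolding profile_mass_def[abs_def] by (intro continuous_intros) auto
  then have "((\<lambda>t. profile_mass k (exp t)) \<longlongrightarrow> profile_mass k 0) at_bot"
    by (rule isCont_tendsto_compose[OF _ exp_at_bot])
  moreover have "(\<Sum>i\<le>k. 0 ^ i / fact i) = (1::real)"
    by (induction k) auto
  ultimately show ?thesis by (simp add: profile_mass_def)
qed

lemma profile_mass_top:
  "((\<lambda>t. profile_mass k (exp t)) \<longlongrightarrow> 1 / (real (k + 2) * real (k + 1))) at_top"
proof -
  have "((\<lambda>x::real. \<Sum>i\<le>k. (x ^ i / exp x) / fact i) \<longlongrightarrow> (\<Sum>i\<le>k. 0 / fact i)) at_top"
    by (intro tendsto_intros tendsto_power_div_exp_0) auto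
  moreover have "(\<lambda>x::real. \<Sum>i\<le>k. (x ^ i / exp x) / fact i) = (\<lambda>x. exp (- x) * (\<Sum>i\<le>k. x ^ i / fact i))"
    by (simp add: exp_minus sum_distrib_left field_simps)
  ultimately have "((\<lambda>x::real. exp (- x) * (\<Sum>i\<le>k. x ^ i / fact i)) \<longlongrightarrow> 0) at_top" by simp
  then have "(profile_mass k \<longlongrightarrow> (1 - 0) / (real (k + 2) * real (k + 1))) at_top"
    unfolding profile_mass_def[abs_def] by (intro tendsto_divide tendsto_diff tendsto_const) auto
  from filterlim_compose[OF this exp_at_top] show ?thesis by simp
qed

section \<open>Poisson approximation of the binomial weights\<close>

lemma Suc_mult_choose_Suc: "Suc m * (n choose Suc m) = (n choose m) * (n - m)"
  using binomial_absorb_comp[of n m] binomial_absorption[of m n] by (simp add: mult.commute)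

lemma prod_falling: "(\<Prod>i\<in>{0..<m}. n - i) = fact m * (n choose m)"
proof (induction m)
  case (Suc m)
  have "(\<Prod>i\<in>{0..<Suc m}. n - i) = fact m * ((n choose m) * (n - m))"
    using Suc by simp
  also have "\<dots> = fact (Suc m) * (n choose Suc m)"
    unfolding Suc_mult_choose_Suc[symmetric] by (simp only: fact_Suc of_nat_id mult_ac)
  finally show ?case .
qed simp

lemma falling_factorial_bounds:
  assumes "m \<le> n" "n > 0"
  shows "fact m * real (n choose m) \<le> real n ^ m"
    and "real n ^ m * (1 - (real m)\<^sup>2 / n) \<le> fact m * real (n choose m)"
proof -
  have "fact m * real (n choose m) \<le> real n ^ m \<and>
    real n ^ m * (1 - (real m)\<^sup>2 / n) \<le> fact m * real (n choose m)"
    using assms(1)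
  proof (induction m)
    case 0
    show ?case by simp
  next
    case (Suc m)

    have step: "fact (Suc m) * real (n choose Suc m) = fact m * real (n choose m) * (real n - real m)"
    proof -
      have "real (Suc m * (n choose Suc m)) = real ((n choose m) * (n - m))"
        by (simp only: Suc_mult_choose_Suc)
      then have "real (Suc m) * real (n choose Suc m) = real (n choose m) * (real n - real m)"
        using Suc.prems by (simp only: of_nat_mult of_nat_diff Suc_leD)
      then have "fact m * (real (Suc m) * real (n choose Suc m))
          = fact m * (real (n choose m) * (real n - real m))" by (rule arg_cong)
      then show ?thesis by (simp only: fact_Suc of_nat_mult mult_ac)
    qed
    have upper: "fact (Suc m) * real (n choose Suc m) \<le> real n ^ Suc m"
    proof -
      have "fact m * real (n choose m) * (real n - real m) \<le> real n ^ m * real n"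
        using Suc by (intro mult_mono) auto
      then show ?thesis unfolding step by (simp only: power_Suc mult.commute)
    qed
    have lower: "real n ^ Suc m * (1 - (real (Suc m))\<^sup>2 / n) \<le> fact (Suc m) * real (n choose Suc m)"
    proof -
      have "real n ^ Suc m * (1 - (real (Suc m))\<^sup>2 / n)
          \<le> real n ^ Suc m * ((1 - (real m)\<^sup>2 / n) * (1 - real m / n))"
      proof (intro mult_left_mono)
        have "(1 - u) * (1 - v) = 1 - u - v + u * v" for u v :: real by (simp add: algebra_simps)
        from this[of "(real m)\<^sup>2 / n" "real m / n"]
        have "(1 - (real m)\<^sup>2 / n) * (1 - real m / n)
            = 1 - (real m)\<^sup>2 / n - real m / n + (real m)\<^sup>2 / n * (real m / n)" .
        moreover have "(real m)\<^sup>2 / n * (real m / n) \<ge> 0" by simp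
        moreover have "(real (Suc m))\<^sup>2 / n = (real m)\<^sup>2 / n + 2 * (real m / n) + 1 / n"
          by (simp add: power2_eq_square add_divide_distrib algebra_simps)
        moreover have "real m / n \<ge> 0" "1 / real n \<ge> 0" by auto
        ultimately show "1 - (real (Suc m))\<^sup>2 / n \<le> (1 - (real m)\<^sup>2 / n) * (1 - real m / n)"
          by linarith
      qed simp
      also have "\<dots> = real n ^ m * (1 - (real m)\<^sup>2 / n) * (real n - real m)"
      proof -
        have e: "real n * (1 - real m / n) = real n - real m"
          using assms(2) by (simp add: right_diff_distrib)
        show ?thesis unfolding e[symmetric] by (simp only: power_Suc mult_ac)
      qed
      also have "\<dots> \<le> fact m * real (n choose m) * (real n - real m)"
        using Suc by (intro mult_right_mono) auto
      finally show ?thesis unfolding step .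
    qed
    from upper lower show ?case by blast
  qed
  then show "fact m * real (n choose m) \<le> real n ^ m"
    and "real n ^ m * (1 - (real m)\<^sup>2 / n) \<le> fact m * real (n choose m)"
    by blast+
qed

text \<open>
  The lower bound uses \<open>1 - y \<ge> (1 - y\<^sup>2) * exp (- y)\<close> followed by Bernoulli's inequality; the upper
  bound compares \<open>(1 - y) ^ (n - m)\<close> with \<open>(1 - y) ^ n \<le> exp (- n * y)\<close>.
\<close>

lemma binomial_poisson_bounds:
  fixes y :: real
  assumes "0 \<le> y" "y \<le> 1" "m \<le> n"
  shows "exp (- (n * y)) * (1 - n * y\<^sup>2) \<le> (1 - y) ^ (n - m)"
    and "(1 - y) ^ (n - m) \<le> exp (- (n * y)) * (1 + real m * exp m * y)"
    and "(1 - y) ^ (n - m) \<le> exp (- (n * y)) * exp m"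
proof -
  have e: "1 - y \<le> exp (- y)" using exp_ge_add_one_self[of "-y"] by simp
  have pow: "(1 - y) ^ j \<le> exp (- (real j * y))" for j
    using power_mono[OF e, of j] assms by (simp add: exp_of_nat_mult[symmetric])
  show 3: "(1 - y) ^ (n - m) \<le> exp (- (n * y)) * exp m"
  proof -
    have "(1 - y) ^ (n - m) \<le> exp (- (real (n - m) * y))" by (rule pow)
    also have "\<dots> \<le> exp (- (n * y) + m)"
    proof -
      have "real m * y \<le> real m" using assms by (simp add: mult_left_le)
      then show ?thesis using assms by (simp add: of_nat_diff algebra_simps)
    qed
    finally show ?thesis by (simp only: exp_add)
  qed
  have le: "(1 - y) ^ n \<le> (1 - y) ^ (n - m)"
    using assms by (intro power_decreasing) auto
  show "exp (- (n * y)) * (1 - n * y\<^sup>2) \<le> (1 - y) ^ (n - m)"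
  proof -
    have y2: "y\<^sup>2 \<le> 1" using assms by (simp add: power_le_one)
    have "1 - y\<^sup>2 = (1 - y) * (1 + y)" by (simp add: power2_eq_square algebra_simps)
    also have "\<dots> \<le> (1 - y) * exp y"
      using assms exp_ge_add_one_self[of y] by (intro mult_left_mono) auto
    finally have "(1 - y\<^sup>2) ^ n \<le> ((1 - y) * exp y) ^ n"
      using y2 by (intro power_mono) auto
    moreover have "1 + real n * (- y\<^sup>2) \<le> (1 + (- y\<^sup>2)) ^ n"
      using y2 by (intro Bernoulli_inequality) auto
    ultimately have "1 - n * y\<^sup>2 \<le> (1 - y) ^ n * exp (n * y)"
      by (simp add: power_mult_distrib exp_of_nat_mult)
    then have "exp (- (n * y)) * (1 - n * y\<^sup>2) \<le> exp (- (n * y)) * ((1 - y) ^ n * exp (n * y))"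
      by (intro mult_left_mono) auto
    also have "\<dots> = (1 - y) ^ n" by (simp add: exp_minus)
    finally show ?thesis using le by linarith
  qed
  show "(1 - y) ^ (n - m) \<le> exp (- (n * y)) * (1 + real m * exp m * y)"
  proof -
    have "1 - real m * y \<le> (1 - y) ^ m"
      using Bernoulli_inequality[of "-y" m] assms by simp
    then have "(1 - y) ^ (n - m) * (1 - real m * y) \<le> (1 - y) ^ (n - m) * (1 - y) ^ m"
      using assms by (intro mult_left_mono) auto
    also have "\<dots> = (1 - y) ^ n" using assms by (simp add: power_add[symmetric])
    also have "\<dots> \<le> exp (- (n * y))" by (rule pow)
    finally have "(1 - y) ^ (n - m) \<le> exp (- (n * y)) + (1 - y) ^ (n - m) * (real m * y)"
      by (simp add: algebra_simps)
    also have "\<dots> \<le> exp (- (n * y)) + exp (- (n * y)) * exp m * (real m * y)"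
      using 3 assms by (intro add_left_mono mult_right_mono) auto
    finally show ?thesis by (simp add: algebra_simps)
  qed
qed

definition depoisson_const :: "nat \<Rightarrow> real" where
  "depoisson_const k = (let m = k + 2 in
     ((real m)\<^sup>2 * exp m * bump_const k + real m * exp m * bump_const (k + 1) + bump_const (k + 2))
       / fact m)"

text \<open>
  With \<open>x = n * y\<close>, both factors of the binomial weight differ from their Poisson counterparts by a
  relative error of order \<open>1 / n\<close> times a polynomial in \<open>x\<close>. The \<open>1 / n\<close> cancels the factor \<open>n\<close> in
  front, so the bound sums over all words to a constant.
\<close>

lemma binomial_poisson_error:
  fixes y :: real
  assumes y: "0 \<le> y" "y \<le> 1" and n: "k + 2 \<le> n"
  shows "\<bar>real (n choose (k + 2)) * y ^ (k + 2) * (1 - y) ^ (n - (k + 2)) - n * (y * profile k (n * y))\<bar>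
     \<le> depoisson_const k * (y * bump (n * y))"
proof -
  define m where "m = k + 2"
  define x where "x = n * y"
  define b where "b = (1 - y) ^ (n - m)"
  \<comment> \<open>\<open>r\<close> and \<open>b\<close> are the factors whose Poisson limits are \<open>1\<close> and \<open>exp (- x)\<close>.\<close>
  define r where "r = fact m * real (n choose m) / real n ^ m"
  have n0: "n > 0" using n by simp
  have x: "x \<ge> 0" using y by (simp add: x_def)
  have r: "r \<le> 1" "1 - (real m)\<^sup>2 / n \<le> r"
    using falling_factorial_bounds[of m n] n n0 by (auto simp: r_def m_def field_simps)
  have b: "exp (- x) * (1 - n * y\<^sup>2) \<le> b" "b \<le> exp (- x) * (1 + real m * exp m * y)"
     "b \<le> exp (- x) * exp m" "b \<ge> 0"
    using binomial_poisson_bounds[of y m n] y n by (auto simp: b_def x_def m_def)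
  have "r * b - exp (- x) \<le> exp (- x) * (real m * exp m * y)"
    using mult_right_mono[OF r(1) b(4)] b(2) by (simp add: algebra_simps)
  moreover have "exp (- x) - r * b \<le> exp (- x) * ((real m)\<^sup>2 / n * exp m + n * y\<^sup>2)"
  proof -
    have "(1 - r) * b \<le> (real m)\<^sup>2 / n * (exp (- x) * exp m)"
      using r b by (intro mult_mono) auto
    then show ?thesis using b(1) by (simp add: algebra_simps)
  qed
  moreover have "exp (- x) * (real m * exp m * y) \<ge> 0"
    "exp (- x) * ((real m)\<^sup>2 / n * exp m + n * y\<^sup>2) \<ge> 0" using y by auto
  ultimately have "\<bar>r * b - exp (- x)\<bar>
      \<le> exp (- x) * (real m * exp m * y) + exp (- x) * ((real m)\<^sup>2 / n * exp m + n * y\<^sup>2)"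
    by linarith
  also have "\<dots> = exp (- x) / n * ((real m)\<^sup>2 * exp m + real m * exp m * x + x\<^sup>2)"
    using n0 by (simp add: x_def field_simps power2_eq_square)
  finally have rb: "\<bar>r * b - exp (- x)\<bar> \<le> exp (- x) / n * ((real m)\<^sup>2 * exp m + real m * exp m * x + x\<^sup>2)" .
  have "real (n choose m) * y ^ m * b - n * (y * profile k x) = x ^ m / fact m * (r * b - exp (- x))"
  proof -
    have "real (n choose m) * y ^ m = x ^ m / fact m * r"
      using n0 by (simp add: r_def x_def power_mult_distrib)
    moreover have "n * (y * profile k x) = x ^ m / fact m * exp (- x)"
      by (simp add: profile_def x_def m_def mult_ac del: fact_Suc)
    ultimately show ?thesis by (simp add: right_diff_distrib)
  qed
  also have "\<bar>\<dots>\<bar> = x ^ m / fact m * \<bar>r * b - exp (- x)\<bar>"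
    using x by (simp add: abs_mult)
  also have "\<dots> \<le> x ^ m / fact m * (exp (- x) / n * ((real m)\<^sup>2 * exp m + real m * exp m * x + x\<^sup>2))"
    using rb x by (intro mult_left_mono) auto
  also have "\<dots> = y * ((real m)\<^sup>2 * exp m * (x ^ (k + 1) * exp (- x))
      + real m * exp m * (x ^ (k + 1 + 1) * exp (- x)) + x ^ (k + 2 + 1) * exp (- x)) / fact m"
  proof -
    have "x ^ m = n * y * x ^ (k + 1)" by (simp add: m_def x_def)
    then have "x ^ m / fact m * (exp (- x) / n * z) = y * (x ^ (k + 1) * exp (- x) * z) / fact m" for z
      using n0 by (simp add: field_simps)
    then show ?thesis by (simp only:) (simp add: algebra_simps power2_eq_square)
  qed
  also have "\<dots> \<le> y * ((real m)\<^sup>2 * exp m * (bump_const k * bump x)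
      + real m * exp m * (bump_const (k + 1) * bump x) + bump_const (k + 2) * bump x) / fact m"
    using x y by (intro divide_right_mono mult_left_mono add_mono power_exp_le_bump) auto
  also have "\<dots> = depoisson_const k * (y * bump x)"
    unfolding depoisson_const_def Let_def m_def[symmetric] by (simp add: algebra_simps add_divide_distrib)
  finally show ?thesis by (simp add: b_def m_def x_def)
qed

lemma depoisson_const_nonneg: "depoisson_const k \<ge> 0"
  by (simp add: depoisson_const_def bump_const_def Let_def)

lemma (in letter_probs) word_sum_depoissonize:
  assumes n: "k + 2 \<le> n"
  defines "f \<equiv> \<lambda>w. real (n choose (k + 2)) * word_prob p w ^ (k + 2) * (1 - word_prob p w) ^ (n - (k + 2))"
  shows "f summable_on UNIV"
    and "\<bar>(\<Sum>\<^sub>\<infinity>w. f w) - n * word_sum p (profile k) n\<bar> \<le> depoisson_const k / decay"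
proof -
  define h where "h w = n * (word_prob p w * profile k (n * word_prob p w))" for w
  have err: "\<bar>f w - h w\<bar> \<le> depoisson_const k * (word_prob p w * bump (n * word_prob p w))" for w
    unfolding f_def h_def using word_prob_pos[of w] word_prob_le_1[of w] n
    by (intro binomial_poisson_error) auto
  have d: "(\<lambda>w. f w - h w) summable_on UNIV"
    by (rule dominated_summable[OF _ depoisson_const_nonneg err]) simp
  have h: "h summable_on UNIV"
    unfolding h_def
    by (intro summable_on_cmult_right word_sum_summable(1)[OF profile_le_bump]) auto
  have hs: "(\<Sum>\<^sub>\<infinity>w. h w) = n * word_sum p (profile k) n"
    unfolding h_def word_sum_def by (rule infsum_cmult_right')
  have "(\<lambda>w. (f w - h w) + h w) summable_on UNIV" by (rule summable_on_add[OF d h])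
  then show "f summable_on UNIV" by simp
  have "(\<Sum>\<^sub>\<infinity>w. (f w - h w) + h w) = (\<Sum>\<^sub>\<infinity>w. f w - h w) + (\<Sum>\<^sub>\<infinity>w. h w)"
    by (rule infsum_add[OF d h])
  then have "\<bar>(\<Sum>\<^sub>\<infinity>w. f w) - n * word_sum p (profile k) n\<bar> = \<bar>\<Sum>\<^sub>\<infinity>w. f w - h w\<bar>"
    by (simp add: hs)
  also have "\<dots> \<le> depoisson_const k * (real n / (1 + real n)) / decay"
    by (rule dominated_infsum_le[OF _ depoisson_const_nonneg err]) simp
  also have "\<dots> \<le> depoisson_const k * 1 / decay"
    using depoisson_const_nonneg decay_pos
    by (intro divide_right_mono mult_left_mono) (auto simp: field_simps)
  finally show "\<bar>(\<Sum>\<^sub>\<infinity>w. f w) - n * word_sum p (profile k) n\<bar> \<le> depoisson_const k / decay" by simp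
qed

section \<open>Occurrences of a motif\<close>

lemma word_prefix_append:
  "word_prefix (u @ v) s \<longleftrightarrow> word_prefix u s \<and> word_prefix v (sdrop (length u) s)"
  by (induction u arbitrary: s) auto

lemma word_prefix_iff_nth: "word_prefix w s \<longleftrightarrow> (\<forall>k\<in>{0..<length w}. s !! k = w ! k)"
  using list_eq_iff_nth_eq[of "stake (length w) s" w] by (auto simp: word_prefix_def)

lemma word_prefix_mono: "prefix u w \<Longrightarrow> word_prefix w s \<Longrightarrow> word_prefix u s"
  by (auto simp: prefix_def word_prefix_append)

lemma word_prefix_comparable:
  assumes "word_prefix u s" "word_prefix v s"
  shows "prefix u v \<or> prefix v u"
proof -
  have *: "prefix u v" if "word_prefix u s" "word_prefix v s" "length u \<le> length v" for u v
  proof -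
    have "take (length u) v = take (length u) (stake (length v) s)"
      using that by (simp only: word_prefix_def)
    also have "\<dots> = stake (length u) s" using that by (simp add: take_stake min_absorb1)
    also have "\<dots> = u" using that by (simp only: word_prefix_def)
    finally show ?thesis by (metis take_is_prefix)
  qed
  show ?thesis using *[of u v] *[of v u] assms by linarith
qed

lemma shortest_unique_prefix_unique:
  assumes "shortest_unique_prefix I s i u" "shortest_unique_prefix I s i v"
  shows "u = v"
proof -
  have *: "\<not> strict_prefix u v"
    if "shortest_unique_prefix I s i u" "shortest_unique_prefix I s i v" for u v
    using that unfolding shortest_unique_prefix_def by blast
  have "prefix u v \<or> prefix v u"
    using assms by (intro word_prefix_comparable[of _ "s i"]) (auto simp: shortest_unique_prefix_def)
  then show ?thesis using *[OF assms] *[OF assms(2,1)] by (auto simp: strict_prefix_def)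
qed

lemma motif_incomparable:
  assumes "motif T" "V \<in> T" "W \<in> T" "word_prefix V s" "word_prefix W s"
  shows "V = W"
  using word_prefix_comparable[OF assms(4,5)] assms(1-3) by (auto simp: motif_def)

text \<open>
  For as many strings as the motif has words, the shape condition loses its minimality clauses: the
  motif property already guarantees that each \<open>W\<close> in \<open>T\<close> is the shortest prefix distinguishing its
  string from the others. Only finitely many prefix conditions remain.
\<close>

lemma trie_shape_eq_motif_iff:
  assumes T: "motif T" and J: "finite J" "card J = card T"
  shows "trie_shape J s = T \<longleftrightarrow> (\<exists>\<theta>. bij_betw \<theta> T J \<and> (\<forall>W\<in>T. word_prefix W (s (\<theta> W))))"
proof
  assume eq: "trie_shape J s = T"
  then have "\<forall>W\<in>T. \<exists>i\<in>J. shortest_unique_prefix J s i W" by (auto simp: trie_shape_def)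
  then obtain \<theta> where \<theta>: "\<And>W. W \<in> T \<Longrightarrow> \<theta> W \<in> J"
      "\<And>W. W \<in> T \<Longrightarrow> shortest_unique_prefix J s (\<theta> W) W" by metis
  have inj: "inj_on \<theta> T"
    using \<theta>(2) by (intro inj_onI) (metis shortest_unique_prefix_unique)
  then have "\<theta> ` T = J"
    using J \<theta>(1) by (intro card_subset_eq) (auto simp: card_image)
  then show "\<exists>\<theta>. bij_betw \<theta> T J \<and> (\<forall>W\<in>T. word_prefix W (s (\<theta> W)))"
    using inj \<theta>(2) by (intro exI[of _ \<theta>]) (auto simp: bij_betw_def shortest_unique_prefix_def)
next
  assume "\<exists>\<theta>. bij_betw \<theta> T J \<and> (\<forall>W\<in>T. word_prefix W (s (\<theta> W)))"
  then obtain \<theta> where bij: "bij_betw \<theta> T J" and pre: "\<And>W. W \<in> T \<Longrightarrow> word_prefix W (s (\<theta> W))"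
    by blast
  have short: "shortest_unique_prefix J s (\<theta> W) W" if W: "W \<in> T" for W
    unfolding shortest_unique_prefix_def
  proof (intro conjI ballI allI impI)
    show "word_prefix W (s (\<theta> W))" using W by (rule pre)
  next
    fix j assume j: "j \<in> J - {\<theta> W}"
    then obtain V where V: "V \<in> T" "j = \<theta> V" using bij by (auto simp: bij_betw_def)
    then show "\<not> word_prefix W (s j)"
      using motif_incomparable[OF T W V(1), of "s j"] pre[OF V(1)] j by auto
  next
    fix v assume v: "strict_prefix v W"
    then have "W \<noteq> []" by auto
    then have "prefix v (butlast W)" using v by (metis append_butlast_last_id prefix_snoc strict_prefix_def)
    moreover obtain V where V: "V \<in> T" "V \<noteq> W" "prefix (butlast W) V"
      using T W by (auto simp: motif_def)
    ultimately have "word_prefix v (s (\<theta> V))"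
      using pre[OF V(1)] by (metis word_prefix_mono)
    moreover have "\<theta> V \<in> J - {\<theta> W}"
      using bij V W by (auto simp: bij_betw_def inj_on_eq_iff)
    ultimately show "\<exists>j\<in>J - {\<theta> W}. word_prefix v (s j)" by blast
  qed
  show "trie_shape J s = T"
  proof (intro equalityI subsetI)
    fix w assume "w \<in> trie_shape J s"
    then obtain i where i: "i \<in> J" "shortest_unique_prefix J s i w" by (auto simp: trie_shape_def)
    then obtain W where "W \<in> T" "i = \<theta> W" using bij by (auto simp: bij_betw_def)
    then show "w \<in> T" using shortest_unique_prefix_unique[OF i(2)] short by metis
  next
    fix W assume "W \<in> T"
    then show "W \<in> trie_shape J s"
      using short bij by (auto simp: trie_shape_def bij_betw_def)
  qed
qed

text \<open>
  \<open>\<theta>\<close> tells which string ends in the external node reached by \<open>w\<close> followed by a word of the motif.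
  Encoding both the set of strings below \<open>w\<close> and their order by one injective map makes the
  events below products over independent strings.
\<close>

definition fills_motif :: "'a list set \<Rightarrow> 'i set \<Rightarrow> ('i \<Rightarrow> 'a stream) \<Rightarrow> 'a list \<Rightarrow> ('a list \<Rightarrow> 'i) \<Rightarrow> bool" where
  "fills_motif T I s w \<theta> \<longleftrightarrow>
     (\<forall>W\<in>T. word_prefix (w @ W) (s (\<theta> W))) \<and> (\<forall>i\<in>I - \<theta> ` T. \<not> word_prefix w (s i))"

definition placements :: "'a list set \<Rightarrow> 'i set \<Rightarrow> ('a list \<Rightarrow> 'i) set" where
  "placements T I = {\<theta> \<in> T \<rightarrow>\<^sub>E I. inj_on \<theta> T}"

lemma finite_placements: "finite T \<Longrightarrow> finite I \<Longrightarrow> finite (placements T I)"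
  unfolding placements_def by (rule finite_subset[of _ "T \<rightarrow>\<^sub>E I"]) (auto intro: finite_PiE)

lemma card_placements:
  assumes "finite T" "finite I"
  shows "card (placements T I) = fact (card T) * (card I choose card T)"
proof -
  have "card (placements T I) = (\<Prod>i\<in>{0..<card T}. card I - i)"
    using card_inj_on_subset_funcset[of T I T] assms by (simp add: placements_def)
  also have "\<dots> = fact (card T) * (card I choose card T)"
    by (rule prod_falling)
  finally show ?thesis .
qed

lemma fills_motif_range:
  assumes "fills_motif T I s w \<theta>" "\<theta> \<in> placements T I"
  shows "{i \<in> I. word_prefix w (s i)} = \<theta> ` T"
  using assms by (auto simp: fills_motif_def placements_def word_prefix_append)

lemma occurs_at_iff:
  assumes T: "motif T" and I: "finite I"
  shows "occurs_at T I s w \<longleftrightarrow> (\<exists>\<theta>\<in>placements T I. fills_motif T I s w \<theta>)"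
proof
  define J where "J = {i \<in> I. word_prefix w (s i)}"
  have J: "finite J" "J \<subseteq> I" using I by (auto simp: J_def)
  {
    assume "occurs_at T I s w"
    then have "card J = card T" "trie_shape J (\<lambda>i. sdrop (length w) (s i)) = T"
      by (simp_all add: occurs_at_def J_def Let_def)
    then obtain \<theta> where \<theta>: "bij_betw \<theta> T J" "\<And>W. W \<in> T \<Longrightarrow> word_prefix W (sdrop (length w) (s (\<theta> W)))"
      using trie_shape_eq_motif_iff[OF T J(1), of "\<lambda>i. sdrop (length w) (s i)"] by auto
    define \<theta>' where "\<theta>' = restrict \<theta> T"
    have \<theta>': "bij_betw \<theta>' T J" "\<And>W. W \<in> T \<Longrightarrow> word_prefix W (sdrop (length w) (s (\<theta>' W)))"
      using \<theta> by (auto simp: \<theta>'_def bij_betw_restrict_eq)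
    then have "\<theta>' \<in> placements T I"
      using J by (auto simp: placements_def \<theta>'_def bij_betw_def)
    moreover have "fills_motif T I s w \<theta>'"
    proof -
      have "\<theta>' ` T = J" using \<theta>'(1) by (simp add: bij_betw_def)
      then show ?thesis using \<theta>'(2) by (auto simp: fills_motif_def word_prefix_append J_def)
    qed
    ultimately show "\<exists>\<theta>\<in>placements T I. fills_motif T I s w \<theta>" by blast
  next
    assume "\<exists>\<theta>\<in>placements T I. fills_motif T I s w \<theta>"
    then obtain \<theta> where \<theta>: "\<theta> \<in> placements T I" "fills_motif T I s w \<theta>" by blast
    then have "\<theta> ` T = J" by (simp add: J_def fills_motif_range)
    then have bij: "bij_betw \<theta> T J" using \<theta>(1) by (simp add: bij_betw_def placements_def)
    then have "card J = card T" by (simp add: bij_betw_same_card)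
    moreover have "trie_shape J (\<lambda>i. sdrop (length w) (s i)) = T"
      using bij \<theta>(2) \<open>card J = card T\<close>
      by (auto simp: trie_shape_eq_motif_iff[OF T J(1)] fills_motif_def word_prefix_append)
    ultimately show "occurs_at T I s w" by (simp add: occurs_at_def J_def Let_def)
  }
qed

lemma fills_motif_unique:
  assumes T: "motif T" and "\<theta> \<in> placements T I" "\<theta>' \<in> placements T I"
    and "fills_motif T I s w \<theta>" "fills_motif T I s w \<theta>'"
  shows "\<theta> = \<theta>'"
proof (rule PiE_ext)
  show "\<theta> \<in> T \<rightarrow>\<^sub>E I" "\<theta>' \<in> T \<rightarrow>\<^sub>E I" using assms by (auto simp: placements_def)
  fix W assume W: "W \<in> T"
  have "\<theta> ` T = \<theta>' ` T"
    using fills_motif_range[OF assms(4,2)] fills_motif_range[OF assms(5,3)] by simp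
  then obtain V where V: "V \<in> T" "\<theta> W = \<theta>' V" using W by blast
  then have "word_prefix W (sdrop (length w) (s (\<theta> W)))" "word_prefix V (sdrop (length w) (s (\<theta> W)))"
    using assms W by (auto simp: fills_motif_def word_prefix_append)
  then show "\<theta> W = \<theta>' W" using motif_incomparable[OF T W V(1)] V by auto
qed

lemma finite_common_prefixes:
  assumes "s \<noteq> t"
  shows "finite {w. word_prefix w s \<and> word_prefix w t}"
proof -
  obtain N where N: "s !! N \<noteq> t !! N"
    using assms stream_smap_nats[of s] stream_smap_nats[of t] by (metis ext)
  have "{w. word_prefix w s \<and> word_prefix w t} \<subseteq> (\<lambda>l. stake l s) ` {..N}"
  proof
    fix w assume "w \<in> {w. word_prefix w s \<and> word_prefix w t}"
    then have w: "stake (length w) s = w" "stake (length w) t = w" by (auto simp: word_prefix_def)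
    have "length w \<le> N"
      using N w stake_nth[of N "length w" s] stake_nth[of N "length w" t] by (cases "N < length w") auto
    then show "w \<in> (\<lambda>l. stake l s) ` {..N}" using w by (intro image_eqI[of _ _ "length w"]) auto
  qed
  then show ?thesis by (rule finite_subset) auto
qed

text \<open>
  Without finiteness the cardinality in \<open>occurrences\<close> would be \<open>0\<close>. It holds for every outcome, even if
  some strings coincide: the strings that fill two different words of the motif are different, and
  \<open>w\<close> is a common prefix of them.
\<close>

lemma finite_occurrences:
  assumes T: "motif T" and I: "finite I"
  shows "finite {w. occurs_at T I s w}"
proof -
  define D where "D = {(i, j). i \<in> I \<and> j \<in> I \<and> s i \<noteq> s j}"
  have "{w. occurs_at T I s w} \<subseteq> (\<Union>(i, j)\<in>D. {w. word_prefix w (s i) \<and> word_prefix w (s j)})"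
  proof
    fix w assume "w \<in> {w. occurs_at T I s w}"
    then obtain \<theta> where \<theta>: "\<theta> \<in> placements T I" "fills_motif T I s w \<theta>"
      using occurs_at_iff[OF T I] by blast
    have "card T \<ge> 2" using T by (simp add: motif_def)
    then obtain V W where VW: "V \<in> T" "W \<in> T" "V \<noteq> W"
      by (metis card_le_Suc0_iff_eq card.infinite not_less_eq_eq numeral_2_eq_2 zero_le)
    then have "word_prefix (w @ V) (s (\<theta> V))" "word_prefix (w @ W) (s (\<theta> W))" "\<theta> V \<in> I" "\<theta> W \<in> I"
      using \<theta> by (auto simp: fills_motif_def placements_def)
    moreover from this have "s (\<theta> V) \<noteq> s (\<theta> W)"
      using motif_incomparable[OF T VW(1,2)] VW(3) by (auto simp: word_prefix_append)
    ultimately show "w \<in> (\<Union>(i, j)\<in>D. {w. word_prefix w (s i) \<and> word_prefix w (s j)})"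
      by (auto simp: D_def word_prefix_append intro!: bexI[of _ "(\<theta> V, \<theta> W)"])
  qed
  moreover have "finite D" using I by (auto simp: D_def intro: finite_subset[of _ "I \<times> I"])
  ultimately show ?thesis
    by (rule finite_subset[OF _ finite_UN_I]) (auto simp: D_def intro: finite_common_prefixes)
qed

locale random_strings = prob_space M + letter_probs p
  for M :: "'w measure" and p :: "'a::finite \<Rightarrow> real" +
  fixes S :: "nat \<Rightarrow> 'w \<Rightarrow> 'a stream"
  assumes source: "memoryless_source M p S"
begin

lemma indep_strings: "indep_vars (\<lambda>_. stream_space (count_space UNIV)) S UNIV"
  using source by (simp add: memoryless_source_def)

lemma measurable_S [measurable]: "S i \<in> measurable M (stream_space (count_space UNIV))"
  using indep_strings by (simp add: indep_vars_def)

lemma sets_word_prefix: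
  fixes w :: "'a list"
  shows "{s. word_prefix w s} \<in> sets (stream_space (count_space UNIV))"
proof -
  have "{s \<in> space (stream_space (count_space UNIV)). stake (length w) s = w}
      \<in> sets (stream_space (count_space (UNIV :: 'a set)))"
    by measurable
  then show ?thesis by (simp add: word_prefix_def space_stream_space)
qed

lemma prob_word_prefix: "prob {\<omega> \<in> space M. word_prefix w (S i \<omega>)} = word_prob p w"
proof (cases "w = []")
  case True
  then show ?thesis by (simp add: prob_space)
next
  case False
  have ind: "indep_vars (\<lambda>_. count_space UNIV) (\<lambda>k \<omega>. S i \<omega> !! k) UNIV"
    using source by (simp add: memoryless_source_def)
  have "{\<omega> \<in> space M. word_prefix w (S i \<omega>)}
      = (\<Inter>k\<in>{0..<length w}. (\<lambda>\<omega>. S i \<omega> !! k) -` {w ! k} \<inter> space M)"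
    using False by (auto simp: word_prefix_iff_nth)
  also have "prob \<dots> = (\<Prod>k\<in>{0..<length w}. prob ((\<lambda>\<omega>. S i \<omega> !! k) -` {w ! k} \<inter> space M))"
    using False by (intro indep_varsD[OF ind]) auto
  also have "\<dots> = (\<Prod>k\<in>{0..<length w}. p (w ! k))"
  proof (rule prod.cong)
    fix k
    have "(\<lambda>\<omega>. S i \<omega> !! k) -` {w ! k} \<inter> space M = {\<omega> \<in> space M. S i \<omega> !! k = w ! k}" by auto
    then show "prob ((\<lambda>\<omega>. S i \<omega> !! k) -` {w ! k} \<inter> space M) = p (w ! k)"
      using source by (simp add: memoryless_source_def)
  qed simp
  also have "\<dots> = word_prob p w"
    by (simp add: word_prob_def prod.list_conv_set_nth)
  finally show ?thesis .
qed

lemma prob_not_word_prefix: "prob {\<omega> \<in> space M. \<not> word_prefix w (S i \<omega>)} = 1 - word_prob p w"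
proof -
  have "S i -` {s. word_prefix w s} \<inter> space M \<in> events"
    using measurable_S sets_word_prefix by (rule measurable_sets)
  also have "S i -` {s. word_prefix w s} \<inter> space M = {\<omega> \<in> space M. word_prefix w (S i \<omega>)}" by auto
  finally show ?thesis
    using prob_neg[of "\<lambda>\<omega>. word_prefix w (S i \<omega>)"] prob_word_prefix by simp
qed

lemma prob_fills_motif:
  assumes T: "motif T" and \<theta>: "\<theta> \<in> placements T {..<n}"
  shows "{\<omega> \<in> space M. fills_motif T {..<n} (\<lambda>i. S i \<omega>) w \<theta>} \<in> events"
    and "prob {\<omega> \<in> space M. fills_motif T {..<n} (\<lambda>i. S i \<omega>) w \<theta>}
      = (\<Prod>W\<in>T. word_prob p W) * word_prob p w ^ card T * (1 - word_prob p w) ^ (n - card T)"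
proof -
  have inj: "inj_on \<theta> T" and im: "\<theta> ` T \<subseteq> {..<n}" using \<theta> by (auto simp: placements_def)
  have finT: "finite T" and "T \<noteq> {}" using T by (auto simp: motif_def)
  then have n: "{..<n} \<noteq> {}" using im by auto
  define A where "A i = (if i \<in> \<theta> ` T then {s. word_prefix (w @ inv_into T \<theta> i) s}
      else {s. \<not> word_prefix w s})" for i
  have A: "A i \<in> sets (stream_space (count_space UNIV))" for i
  proof -
    have "space (stream_space (count_space UNIV)) - {s. word_prefix w s}
        \<in> sets (stream_space (count_space (UNIV :: 'a set)))"
      using sets_word_prefix by (rule sets.compl_sets)
    also have "space (stream_space (count_space UNIV)) - {s. word_prefix w s} = {s. \<not> word_prefix w s}"
      by (auto simp: space_stream_space)
    finally show ?thesis using sets_word_prefix by (simp add: A_def)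
  qed
  have eq: "{\<omega> \<in> space M. fills_motif T {..<n} (\<lambda>i. S i \<omega>) w \<theta>} = (\<Inter>i\<in>{..<n}. S i -` A i \<inter> space M)"
    (is "?E = ?R")
  proof (rule set_eqI)
    fix \<omega>
    have "fills_motif T {..<n} (\<lambda>i. S i \<omega>) w \<theta> \<longleftrightarrow> (\<forall>i\<in>{..<n}. S i \<omega> \<in> A i)"
    proof -
      have "(\<forall>W\<in>T. word_prefix (w @ W) (S (\<theta> W) \<omega>)) \<longleftrightarrow> (\<forall>i\<in>\<theta> ` T. S i \<omega> \<in> A i)"
        using inj by (auto simp: A_def)
      moreover have "(\<forall>i\<in>{..<n} - \<theta> ` T. \<not> word_prefix w (S i \<omega>)) \<longleftrightarrow> (\<forall>i\<in>{..<n} - \<theta> ` T. S i \<omega> \<in> A i)"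
        by (auto simp: A_def)
      ultimately show ?thesis using im unfolding fills_motif_def by blast
    qed
    then show "\<omega> \<in> ?E \<longleftrightarrow> \<omega> \<in> ?R" using n by auto
  qed
  show "?E \<in> events"
    unfolding eq using n A by (intro sets.finite_INT measurable_sets[OF measurable_S]) auto
  have "prob ?E = (\<Prod>i<n. prob (S i -` A i \<inter> space M))"
    unfolding eq using n A by (intro indep_varsD[OF indep_strings]) auto
  also have "\<dots> = (\<Prod>i\<in>\<theta> ` T. prob (S i -` A i \<inter> space M))
      * (\<Prod>i\<in>{..<n} - \<theta> ` T. prob (S i -` A i \<inter> space M))"
    using im by (subst mult.commute) (intro prod.subset_diff, auto)
  also have "(\<Prod>i\<in>\<theta> ` T. prob (S i -` A i \<inter> space M)) = (\<Prod>W\<in>T. word_prob p w * word_prob p W)"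
  proof (subst prod.reindex[OF inj], unfold o_def, rule prod.cong)
    fix W assume "W \<in> T"
    then have "S (\<theta> W) -` A (\<theta> W) \<inter> space M = {\<omega> \<in> space M. word_prefix (w @ W) (S (\<theta> W) \<omega>)}"
      using inj by (auto simp: A_def)
    then show "prob (S (\<theta> W) -` A (\<theta> W) \<inter> space M) = word_prob p w * word_prob p W"
      using prob_word_prefix[of "w @ W"] by simp
  qed simp
  also have "(\<Prod>i\<in>{..<n} - \<theta> ` T. prob (S i -` A i \<inter> space M)) = (1 - word_prob p w) ^ (n - card T)"
  proof -
    have "prob (S i -` A i \<inter> space M) = 1 - word_prob p w" if "i \<in> {..<n} - \<theta> ` T" for i
    proof -
      have "S i -` A i \<inter> space M = {\<omega> \<in> space M. \<not> word_prefix w (S i \<omega>)}"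
        using that by (auto simp: A_def)
      then show ?thesis by (simp add: prob_not_word_prefix)
    qed
    moreover have "card ({..<n} - \<theta> ` T) = n - card T"
      using im finT inj by (simp add: card_Diff_subset card_image)
    ultimately show ?thesis by simp
  qed
  finally show "prob ?E = (\<Prod>W\<in>T. word_prob p W) * word_prob p w ^ card T * (1 - word_prob p w) ^ (n - card T)"
    by (simp add: prod.distrib mult_ac)
qed

text \<open>
  The \<open>\<tau>! * (n choose \<tau>)\<close> placements yield disjoint events of equal probability. The formula is grouped
  so that its first two factors are the shape functional, which is the case \<open>n = \<tau>\<close>, \<open>w = []\<close>.
\<close>

lemma prob_occurs_at:
  assumes T: "motif T"
  shows "{\<omega> \<in> space M. occurs_at T {..<n} (\<lambda>i. S i \<omega>) w} \<in> events"
    and "prob {\<omega> \<in> space M. occurs_at T {..<n} (\<lambda>i. S i \<omega>) w}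
      = fact (card T) * (\<Prod>W\<in>T. word_prob p W) *
        (real (n choose card T) * word_prob p w ^ card T * (1 - word_prob p w) ^ (n - card T))"
proof -
  let ?E = "\<lambda>\<theta>. {\<omega> \<in> space M. fills_motif T {..<n} (\<lambda>i. S i \<omega>) w \<theta>}"
  have fin: "finite (placements T {..<n})" using T by (intro finite_placements) (auto simp: motif_def)
  have eq: "{\<omega> \<in> space M. occurs_at T {..<n} (\<lambda>i. S i \<omega>) w} = (\<Union>\<theta>\<in>placements T {..<n}. ?E \<theta>)"
    using occurs_at_iff[OF T, of "{..<n}"] by auto
  show "{\<omega> \<in> space M. occurs_at T {..<n} (\<lambda>i. S i \<omega>) w} \<in> events"
    unfolding eq using fin prob_fills_motif(1)[OF T] by (intro sets.finite_UN) auto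
  have "prob (\<Union>\<theta>\<in>placements T {..<n}. ?E \<theta>) = (\<Sum>\<theta>\<in>placements T {..<n}. prob (?E \<theta>))"
  proof (rule finite_measure_finite_Union[OF fin])
    show "?E ` placements T {..<n} \<subseteq> events" using prob_fills_motif(1)[OF T] by auto
    show "disjoint_family_on ?E (placements T {..<n})"
      unfolding disjoint_family_on_def
    proof (intro ballI impI)
      fix \<theta> \<theta>' assume "\<theta> \<in> placements T {..<n}" "\<theta>' \<in> placements T {..<n}" "\<theta> \<noteq> \<theta>'"
      then show "?E \<theta> \<inter> ?E \<theta>' = {}"
        using fills_motif_unique[OF T, of \<theta> "{..<n}" \<theta>'] by blast
    qed
  qed
  also have "\<dots> = real (card (placements T {..<n})) *
      ((\<Prod>W\<in>T. word_prob p W) * word_prob p w ^ card T * (1 - word_prob p w) ^ (n - card T))"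
    using prob_fills_motif(2)[OF T] by simp
  also have "card (placements T {..<n}) = fact (card T) * (n choose card T)"
    using T by (subst card_placements) (auto simp: motif_def)
  finally show "prob {\<omega> \<in> space M. occurs_at T {..<n} (\<lambda>i. S i \<omega>) w}
      = fact (card T) * (\<Prod>W\<in>T. word_prob p W) *
        (real (n choose card T) * word_prob p w ^ card T * (1 - word_prob p w) ^ (n - card T))"
    unfolding eq by (simp add: mult_ac)
qed

lemma shape_functional_eq:
  assumes T: "motif T"
  shows "shape_functional M S T = fact (card T) * (\<Prod>W\<in>T. word_prob p W)"
proof -
  have "{\<omega> \<in> space M. trie_shape {..<card T} (\<lambda>i. S i \<omega>) = T}
      = {\<omega> \<in> space M. occurs_at T {..<card T} (\<lambda>i. S i \<omega>) []}"
    by (simp add: occurs_at_def lessThan_def)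
  then show ?thesis
    unfolding shape_functional_def using prob_occurs_at(2)[OF T, of "card T" "[]"] by simp
qed

lemma expectation_occurrences:
  assumes T: "motif T"
    and sum: "(\<lambda>w. real (n choose card T) * word_prob p w ^ card T * (1 - word_prob p w) ^ (n - card T))
       summable_on UNIV"
  shows "expectation (\<lambda>\<omega>. real (occurrences T n (\<lambda>i. S i \<omega>))) = shape_functional M S T *
    (\<Sum>\<^sub>\<infinity>w. real (n choose card T) * word_prob p w ^ card T * (1 - word_prob p w) ^ (n - card T))"
proof -
  let ?f = "\<lambda>w. real (n choose card T) * word_prob p w ^ card T * (1 - word_prob p w) ^ (n - card T)"
  let ?Q = "shape_functional M S T"
  define E where "E w = {\<omega> \<in> space M. occurs_at T {..<n} (\<lambda>i. S i \<omega>) w}" for w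
  have E: "E w \<in> events" "prob (E w) = ?Q * ?f w" for w
    using prob_occurs_at[OF T, of n w] by (simp_all add: E_def shape_functional_eq[OF T])
  \<comment> \<open>The words are enumerated so that expectation and countable sum can be interchanged.\<close>
  define e where "e = from_nat_into (UNIV :: 'a list set)"
  have e: "bij_betw e UNIV UNIV"
    unfolding e_def by (intro bij_betw_from_nat_into) (auto simp: infinite_UNIV_listI)
  have card: "(\<lambda>k. indicat_real (E (e k)) \<omega>) sums real (occurrences T n (\<lambda>i. S i \<omega>))"
    if \<omega>: "\<omega> \<in> space M" for \<omega>
  proof -
    define W where "W = {w. occurs_at T {..<n} (\<lambda>i. S i \<omega>) w}"
    have fin: "finite W" unfolding W_def by (intro finite_occurrences[OF T]) simp
    have bij: "bij_betw e (e -` W) W"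
      using e by (auto simp: bij_betw_def inj_on_def surj_def image_iff)
    then have fin': "finite (e -` W)" using fin bij_betw_finite by blast
    have "(\<lambda>k. indicat_real (E (e k)) \<omega>) sums (\<Sum>k\<in>e -` W. indicat_real (E (e k)) \<omega>)"
      using \<omega> by (intro sums_finite fin') (auto simp: E_def W_def)
    also have "(\<Sum>k\<in>e -` W. indicat_real (E (e k)) \<omega>) = (\<Sum>k\<in>e -` W. 1)"
      using \<omega> by (intro sum.cong) (auto simp: E_def W_def)
    also have "\<dots> = real (card W)" using bij_betw_same_card[OF bij] by simp
    finally show ?thesis by (simp add: occurrences_def W_def)
  qed
  have "(?f has_sum (\<Sum>\<^sub>\<infinity>w. ?f w)) UNIV" using sum by (rule has_sum_infsum)
  then have "((\<lambda>w. prob (E w)) has_sum (?Q * (\<Sum>\<^sub>\<infinity>w. ?f w))) UNIV"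
    unfolding E by (rule has_sum_cmult_right)
  then have "((\<lambda>k. prob (E (e k))) has_sum (?Q * (\<Sum>\<^sub>\<infinity>w. ?f w))) UNIV"
    by (subst has_sum_reindex_bij_betw[OF e])
  then have sums: "(\<lambda>k. prob (E (e k))) sums (?Q * (\<Sum>\<^sub>\<infinity>w. ?f w))"
    by (rule has_sum_imp_sums)
  have int: "expectation (\<lambda>\<omega>. indicat_real (E (e k)) \<omega>) = prob (E (e k))" for k
    using E(1)[of "e k"] by simp
  have "expectation (\<lambda>\<omega>. real (occurrences T n (\<lambda>i. S i \<omega>)))
      = expectation (\<lambda>\<omega>. \<Sum>k. indicat_real (E (e k)) \<omega>)"
    using card by (intro Bochner_Integration.integral_cong refl) (metis sums_unique)
  also have "\<dots> = (\<Sum>k. expectation (\<lambda>\<omega>. indicat_real (E (e k)) \<omega>))"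
  proof (rule integral_suminf)
    show "integrable M (\<lambda>\<omega>. indicat_real (E (e k)) \<omega>)" for k
      using E(1)[of "e k"] by (intro integrable_real_indicator) (auto simp: less_top[symmetric])
    show "AE \<omega> in M. summable (\<lambda>k. norm (indicat_real (E (e k)) \<omega>))"
      using card by (intro AE_I2) (auto dest: sums_summable)
    show "summable (\<lambda>k. expectation (\<lambda>\<omega>. norm (indicat_real (E (e k)) \<omega>)))"
      using sums int by (auto dest: sums_summable)
  qed
  also have "\<dots> = ?Q * (\<Sum>\<^sub>\<infinity>w. ?f w)" unfolding int using sums by (rule sums_unique[symmetric])
  finally show ?thesis .
qed

end

section \<open>Asymptotics of the expected number of occurrences\<close>

theorem proposition1:
  fixes p :: "'a::finite \<Rightarrow> real"
    and M :: "'w measure"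
    and S :: "nat \<Rightarrow> 'w \<Rightarrow> 'a stream"
    and T :: "'a list set"
  assumes "CARD('a) \<ge> 2"
    and "\<And>a. p a > 0"
    and "(\<Sum>a\<in>UNIV. p a) = 1"
    and "prob_space M"
    and "memoryless_source M p S"
    and "motif T"
  shows "\<exists>\<xi>. fluctuating_mean_zero \<xi> \<and>
     (\<lambda>n. prob_space.expectation M (\<lambda>\<omega>. real (occurrences T n (\<lambda>i. S i \<omega>)))
        - (shape_functional M S T / (real (card T) * (real (card T) - 1) * source_entropy p) * real n
           + \<xi> (real n) * real n))
       \<in> o(\<lambda>n. real n) \<and>
     (\<not> periodic_probs p \<longrightarrow> (\<forall>x>0. \<xi> x = 0))"
proof -
  interpret prob_space M by fact
  interpret random_strings M p S
    by unfold_locales (use assms in auto)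
  obtain k where k: "card T = k + 2"
    using assms(6) by (auto simp: motif_def dest!: le_Suc_ex simp: add.commute)
  define Q where "Q = shape_functional M S T"
  define l where "l a = - ln (p a)" for a
  define g where "g t = profile k (exp t)" for t
  define G where "G t = word_sum p (profile k) (exp t)" for t
  define C where "C = bump_const k / fact (k + 2)"
  define D where "D = (real (k + 1) * bump_const k + bump_const (k + 1)) / fact (k + 2)"
  define c where "c = 1 / (real (k + 2) * real (k + 1))"
  have C: "\<bar>profile k x\<bar> \<le> C * bump x" if "x \<ge> 0" for x
    unfolding C_def using that by (rule profile_le_bump)
  have C_nonneg: "C \<ge> 0" by (simp add: C_def bump_const_def)
  have G_le: "\<bar>G t\<bar> \<le> C * (exp t / (1 + exp t)) / decay" for t
    unfolding G_def by (rule word_sum_summable(2)[OF C]) auto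
  interpret renewal_equation_with_mass p l g G "C / decay" "D / decay" c "\<lambda>t. profile_mass k (exp t)"
  proof
    show "p a > 0" for a by (rule p_pos)
    show "(\<Sum>a\<in>UNIV. p a) = 1" by (rule p_sum)
    show "l a > 0" for a using p_pos[of a] p_less_1[of a] by (simp add: l_def)
    show "G t = g t + (\<Sum>a\<in>UNIV. p a * G (t - l a))" for t
    proof -
      have "exp (t - l a) = p a * exp t" for a
        using p_pos[of a] by (simp add: l_def exp_add)
      then show ?thesis using word_sum_renewal[OF C, of "exp t"] by (simp add: G_def g_def)
    qed
    show "\<bar>G t\<bar> \<le> C / decay" for t
    proof -
      have "C * (exp t / (1 + exp t)) / decay \<le> C * 1 / decay"
        using C_nonneg decay_pos
        by (intro divide_right_mono mult_left_mono) (auto simp: field_simps add_pos_pos)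
      then show ?thesis using G_le[of t] by simp
    qed
    show "(g \<longlongrightarrow> 0) at_top"
    proof (rule Lim_null_comparison)
      show "\<forall>\<^sub>F t in at_top. norm (g t) \<le> C * bump (exp t)"
        using C by (auto simp: g_def)
      show "((\<lambda>t. C * bump (exp t)) \<longlongrightarrow> 0) at_top"
        unfolding bump_def by real_asymp
    qed
    show "\<bar>G t - G s\<bar> \<le> D / decay * \<bar>t - s\<bar>" for t s
      unfolding G_def D_def
      by (rule word_sum_exp_lipschitz[OF C profile_has_derivative profile_deriv_le_bump]) auto
    show "(G \<longlongrightarrow> 0) at_bot"
    proof (rule Lim_null_comparison)
      show "\<forall>\<^sub>F t in at_bot. norm (G t) \<le> C * (exp t / (1 + exp t)) / decay"
        using G_le by simp
      have "((\<lambda>t. C * (exp t / (1 + exp t)) / decay) \<longlongrightarrow> C * (0 / (1 + 0)) / decay) at_bot"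
        using decay_pos by (intro tendsto_intros exp_at_bot) auto
      then show "((\<lambda>t. C * (exp t / (1 + exp t)) / decay) \<longlongrightarrow> 0) at_bot" by simp
    qed
    show "g t \<ge> 0" for t by (simp add: g_def profile_nonneg)
    show "((\<lambda>t. profile_mass k (exp t)) has_real_derivative g t) (at t)" for t
      unfolding g_def by (rule profile_mass_has_derivative)
    show "((\<lambda>t. profile_mass k (exp t)) \<longlongrightarrow> 0) at_bot" by (rule profile_mass_bot)
    show "((\<lambda>t. profile_mass k (exp t)) \<longlongrightarrow> c) at_top" unfolding c_def by (rule profile_mass_top)
  qed
  have entropy: "mean_step = source_entropy p"
    unfolding mean_step_def source_entropy_def l_def by (simp add: sum_negf)
  obtain H d where d: "d > 0" and H: "continuous_on UNIV H" "\<And>t. H (t + d) = H t"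
    and mean: "integral {0..d} H = d * (c / mean_step)"
    and lim: "((\<lambda>t. G t - H t) \<longlongrightarrow> 0) at_top"
    and dich: "(\<forall>t. H t = c / mean_step) \<or> (\<forall>a. \<exists>k::int. l a = of_int k * d)"
    by (rule renewal_limit) (rule that)
  define P where "P t = Q * (H t - c / mean_step)" for t
  define \<xi> where "\<xi> x = P (ln x)" for x
  have "fluctuating_mean_zero \<xi>"
    unfolding fluctuating_mean_zero_def
  proof (intro exI conjI allI impI)
    show "d > 0" by (rule d)
    show "continuous_on UNIV P" unfolding P_def by (intro continuous_intros H)
    show "P (t + d) = P t" for t by (simp add: P_def H)
    have "H integrable_on {0..d}"
      by (rule integrable_continuous_interval) (rule continuous_on_subset[OF H(1)], simp)
    then have "integral {0..d} (\<lambda>t. H t - c / mean_step)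
        = integral {0..d} H - integral {0..d} (\<lambda>_. c / mean_step)"
      by (rule integral_diff) (rule integrable_const_ivl)
    then have "integral {0..d} P = Q * (integral {0..d} H - integral {0..d} (\<lambda>_. c / mean_step))"
      unfolding P_def by simp
    then show "integral {0..d} P = 0" using mean d by simp
  qed (simp add: \<xi>_def)
  moreover have "(\<lambda>n. expectation (\<lambda>\<omega>. real (occurrences T n (\<lambda>i. S i \<omega>)))
        - (Q / (real (card T) * (real (card T) - 1) * source_entropy p) * real n + \<xi> (real n) * real n))
       \<in> o(\<lambda>n. real n)" (is "?E \<in> _")
  proof (rule smalloI_tendsto)
    have err: "\<bar>?E n\<bar> \<le> \<bar>Q\<bar> * (depoisson_const k / decay) + \<bar>Q\<bar> * (n * \<bar>G (ln n) - H (ln n)\<bar>)"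
      if n: "n \<ge> k + 2" for n
    proof -
      define F where "F = (\<Sum>\<^sub>\<infinity>w. real (n choose (k + 2)) * word_prob p w ^ (k + 2)
          * (1 - word_prob p w) ^ (n - (k + 2)))"
      have exp: "expectation (\<lambda>\<omega>. real (occurrences T n (\<lambda>i. S i \<omega>))) = Q * F"
        using expectation_occurrences[OF assms(6), of n] word_sum_depoissonize(1)[OF n]
        by (simp only: k Q_def F_def)
      have n0: "n > 0" using n by simp
      have "Q / (real (card T) * (real (card T) - 1) * source_entropy p) = Q * (c / mean_step)"
        by (simp add: k c_def entropy field_simps)
      then have "?E n = Q * F - Q * (n * H (ln n))"
        unfolding exp \<xi>_def P_def by (simp add: algebra_simps)
      also have "\<dots> = Q * (F - n * G (ln n)) + Q * (n * (G (ln n) - H (ln n)))"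
        by (simp add: algebra_simps)
      also have "\<bar>\<dots>\<bar> \<le> \<bar>Q\<bar> * \<bar>F - n * G (ln n)\<bar> + \<bar>Q\<bar> * (n * \<bar>G (ln n) - H (ln n)\<bar>)"
        by (rule order_trans[OF abs_triangle_ineq]) (simp add: abs_mult)
      also have "\<bar>F - n * G (ln n)\<bar> \<le> depoisson_const k / decay"
        using word_sum_depoissonize(2)[OF n] n0 by (simp add: F_def G_def)
      finally show ?thesis by (simp add: mult_left_mono)
    qed
    show "((\<lambda>n. ?E n / real n) \<longlongrightarrow> 0) sequentially"
    proof (rule Lim_null_comparison)
      have "norm (?E n / real n)
          \<le> \<bar>Q\<bar> * (depoisson_const k / decay) / n + \<bar>Q\<bar> * \<bar>G (ln n) - H (ln n)\<bar>" if "n \<ge> k + 2" for n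
        using divide_right_mono[OF err[OF that], of "real n"] that by (simp add: add_divide_distrib)
      then show "\<forall>\<^sub>F n in sequentially. norm (?E n / real n)
          \<le> \<bar>Q\<bar> * (depoisson_const k / decay) / n + \<bar>Q\<bar> * \<bar>G (ln n) - H (ln n)\<bar>"
        by (auto simp: eventually_sequentially)
      have ln_top: "filterlim (\<lambda>n. ln (real n)) at_top sequentially" by real_asymp
      have "(\<lambda>n. \<bar>Q\<bar> * (depoisson_const k / decay) / n + \<bar>Q\<bar> * \<bar>G (ln n) - H (ln n)\<bar>)
          \<longlonglongrightarrow> 0 + \<bar>Q\<bar> * \<bar>0\<bar>"
        by (intro tendsto_add tendsto_mult tendsto_rabs tendsto_const lim_const_over_n
            filterlim_compose[OF lim ln_top])
      then show "(\<lambda>n. \<bar>Q\<bar> * (depoisson_const k / decay) / n + \<bar>Q\<bar> * \<bar>G (ln n) - H (ln n)\<bar>)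
          \<longlonglongrightarrow> 0" by simp
    qed
    show "\<forall>\<^sub>F n in sequentially. real n \<noteq> 0"
      using eventually_gt_at_top[of 0] by eventually_elim simp
  qed
  moreover have "\<forall>x>0. \<xi> x = 0" if "\<not> periodic_probs p"
  proof -
    have "periodic_probs p" if lattice: "\<forall>a. \<exists>k::int. l a = of_int k * d"
      unfolding periodic_probs_def
    proof (intro allI)
      fix a b
      obtain i j :: int where "l a = of_int i * d" "l b = of_int j * d" using lattice by metis
      then have "ln (p a) = - (of_int i * d)" "ln (p b) = - (of_int j * d)"
        unfolding l_def by linarith+
      then have "ln (p a) / ln (p b) = of_int i / of_int j" using d by simp
      then show "ln (p a) / ln (p b) \<in> \<rat>" by simp
    qed
    then show ?thesis using \<open>\<not> periodic_probs p\<close> dich by (auto simp: \<xi>_def P_def)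
  qed
  ultimately show ?thesis unfolding Q_def by blast
qed

end
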